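(* Let $n$ be a positive integer, $H$ an $n\times n$ contraction, $L$ a self-adjoint $n\times n$ matrix, and $p,q\in\mathbf R$. Consider on positive definite $n\times n$ matrices $A$ the trace function \[ \varphi^L_{p,q}(A)=\operatorname{Tr}\Bigl[\exp_p\bigl(L+H^*\log_p(A)H\bigr)^q\Bigr]. \] Then: (a) $\varphi^L_{p,q}$ is concave if $0\le p\le1$, $L\le0$, $0\le q\le1$; (b) $\varphi^L_{p,q}$ is concave if $1\le p\le2$, $L\ge0$, $0\le q\le1$; (c) $\varphi^L_{p,q}$ is convex if $0\le p\le1$, $L\le0$, $q\le0$; (d) $\varphi^L_{p,q}$ is convex if $1\le p\le2$, $L\ge0$, $q\le0$; (e) $\varphi^L_{p,q}$ is convex if $2\le p\le3$, $L\ge0$, $q\ge1$.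
   Context: For $p\in\mathbf R$, the deformed logarithm is $\log_p x=\int_1^x t^{p-2}dt$ for $x>0$, i.e. $\frac{x^{p-1}-1}{p-1}$ for $p\neq1$ and $\log x$ for $p=1$; the deformed exponential $\exp_p$ is its inverse, $\exp_p(x)=(x(p-1)+1)^{1/(p-1)}$ on $x>-(p-1)^{-1}$ when $p>1$, on $x<-(p-1)^{-1}$ when $p<1$, and $\exp_1=\exp$ on $\mathbf R$. Both are applied to self-adjoint matrices by functional calculus. A contraction is a matrix of operator norm at most $1$. Under the stated sign conditions on $L$ ($L\ge0$ when $p>1$, $L\le0$ when $p<1$), the spectrum of $L+H^*\log_p(A)H$ lies in the domain of $\exp_p$, so $\exp_p(L+H^*\log_p(A)H)$ is a positive definite matrix and its $q$-th power is defined by functional calculus. *)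

theory Defs
  imports "Jordan_Normal_Form.Schur_Decomposition"
begin

definition hermitian_mat :: "nat \<Rightarrow> complex mat \<Rightarrow> bool" where
  "hermitian_mat n A \<longleftrightarrow> A \<in> carrier_mat n n \<and> mat_adjoint A = A"

definition unitary_mat :: "nat \<Rightarrow> complex mat \<Rightarrow> bool" where
  "unitary_mat n U \<longleftrightarrow> U \<in> carrier_mat n n \<and> mat_adjoint U * U = 1\<^sub>m n"

definition qform :: "complex mat \<Rightarrow> complex vec \<Rightarrow> complex" where
  "qform A v = (A *\<^sub>v v) \<bullet>c v"

definition pos_def_mat :: "nat \<Rightarrow> complex mat \<Rightarrow> bool" where
  "pos_def_mat n A \<longleftrightarrow> hermitian_mat n A \<and>
     (\<forall>v\<in>carrier_vec n. v \<noteq> 0\<^sub>v n \<longrightarrow> Re (qform A v) > 0)"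

definition pos_semidef_mat :: "nat \<Rightarrow> complex mat \<Rightarrow> bool" where
  "pos_semidef_mat n A \<longleftrightarrow> hermitian_mat n A \<and>
     (\<forall>v\<in>carrier_vec n. Re (qform A v) \<ge> 0)"

definition contraction_mat :: "nat \<Rightarrow> complex mat \<Rightarrow> bool" where
  "contraction_mat n H \<longleftrightarrow> H \<in> carrier_mat n n \<and>
     (\<forall>v\<in>carrier_vec n. Re ((H *\<^sub>v v) \<bullet>c (H *\<^sub>v v)) \<le> Re (v \<bullet>c v))"

definition mat_trace :: "complex mat \<Rightarrow> complex" where
  "mat_trace A = (\<Sum>i<dim_row A. A $$ (i, i))"

definition mat_fun :: "(real \<Rightarrow> real) \<Rightarrow> complex mat \<Rightarrow> complex mat" where
  "mat_fun f A = (SOME B. \<exists>U (d :: nat \<Rightarrow> real).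
      unitary_mat (dim_row A) U \<and>
      A = U * mat_diag (dim_row A) (\<lambda>i. complex_of_real (d i)) * mat_adjoint U \<and>
      B = U * mat_diag (dim_row A) (\<lambda>i. complex_of_real (f (d i))) * mat_adjoint U)"

definition log_p :: "real \<Rightarrow> real \<Rightarrow> real" where
  "log_p p x = (if p = 1 then ln x else (x powr (p - 1) - 1) / (p - 1))"

definition exp_p :: "real \<Rightarrow> real \<Rightarrow> real" where
  "exp_p p x = (if p = 1 then exp x else (x * (p - 1) + 1) powr (1 / (p - 1)))"

definition phi :: "complex mat \<Rightarrow> complex mat \<Rightarrow> real \<Rightarrow> real \<Rightarrow> complex mat \<Rightarrow> real" where
  "phi H L p q A = Re (mat_trace
     (mat_fun (\<lambda>x. x powr q)
        (mat_fun (exp_p p) (L + mat_adjoint H * mat_fun (log_p p) A * H))))"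

definition concave_on_pd :: "nat \<Rightarrow> (complex mat \<Rightarrow> real) \<Rightarrow> bool" where
  "concave_on_pd n f \<longleftrightarrow> (\<forall>A B t. pos_def_mat n A \<longrightarrow> pos_def_mat n B \<longrightarrow>
      0 \<le> t \<longrightarrow> t \<le> 1 \<longrightarrow>
      t * f A + (1 - t) * f B \<le>
      f (complex_of_real t \<cdot>\<^sub>m A + complex_of_real (1 - t) \<cdot>\<^sub>m B))"

definition convex_on_pd :: "nat \<Rightarrow> (complex mat \<Rightarrow> real) \<Rightarrow> bool" where
  "convex_on_pd n f \<longleftrightarrow> (\<forall>A B t. pos_def_mat n A \<longrightarrow> pos_def_mat n B \<longrightarrow>
      0 \<le> t \<longrightarrow> t \<le> 1 \<longrightarrow>
      f (complex_of_real t \<cdot>\<^sub>m A + complex_of_real (1 - t) \<cdot>\<^sub>m B) \<le>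
      t * f A + (1 - t) * f B)"

end

theory Submission
  imports "HOL-Analysis.Equivalence_Lebesgue_Henstock_Integration" Defs
begin

text \<open>
  Put \<open>s = p - 1\<close>. For \<open>p \<noteq> 1\<close> the trace function is \<open>Tr Y(A)\<^bsup>q/s\<^esup>\<close> with
  \<open>Y(A) = M + H\<^sup>* A\<^sup>s H\<close> and \<open>M = s L + 1 - H\<^sup>* H \<ge> 0\<close>; for \<open>p = 1\<close> it is
  \<open>Tr exp (q (L + H\<^sup>* log(A) H))\<close>. Klein's inequality writes such a trace as an extremum over an
  auxiliary positive matrix \<open>B\<close> of \<open>Tr Y(A) h(B) + Tr k(B)\<close>. If it is a supremum of convex (or an
  infimum of concave) functions of \<open>A\<close>, then convexity of the weighted traces \<open>Tr W A\<^sup>s\<close> is enough.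
  Otherwise \<open>B\<close> is parametrized so that \<open>h(B)\<close> is a multiple of \<open>B\<^bsup>1-s\<^esup>\<close>, and the joint
  concavity (Lieb, \<open>0 \<le> s \<le> 1\<close>) or convexity (Ando, \<open>-1 \<le> s \<le> 0\<close> or \<open>1 \<le> s \<le> 2\<close>) of
  \<open>Tr A\<^sup>s K B\<^bsup>1-s\<^esup> K\<^sup>*\<close> gives the result; for \<open>p = 1\<close> the joint convexity of the relative entropy
  replaces it. In eigenbases that trace is a double sum of \<open>a\<^sup>s b\<^bsup>1-s\<^esup> |K\<^bsub>ij\<^esub>|\<^sup>2\<close>, and an integral
  representation of the power reduces joint convexity to the function \<open>a\<^sup>2 / (a + l b)\<close>, whose double
  sum is a supremum of affine functions of \<open>(A, B)\<close>.
\<close>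

text \<open>Eigenbases move with the matrices, so convexity of a spectral double sum in (A, B) does
  not follow entrywise from convexity of its scalar kernel. An inequality between kernels does pass
  to the sums, since the weights |K_ij|^2 are nonnegative; this yields Klein's inequality. Convexity
  itself ultimately comes from functionals that are linear in A and B and touch at the mixture.

  With r = q/s, the position of r relative to 0 and 1 decides whether the envelope is of the
  favourable kind. If not, the auxiliary matrix gets exponent 1 - s because the joint theorems
  concern kernels homogeneous of degree one; what remains is Tr B^e with e = (1 - s) r / (r - 1),
  and the bounds on q place e where this term has the right curvature. The sign of L and the
  contraction property make M positive semidefinite, which controls Tr M h(B) and keeps Y(A)
  positive definite. For p = 1 there is no M: contraction and 0 <= q <= 1 instead make 1 - q H^* H
  positive semidefinite, which absorbs the entropy term left over by the relative entropy.\<close>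

unbundle no vec_syntax

section \<open>Unitary diagonalization\<close>

lemma adjoint_carrier [simp]:
  "A \<in> carrier_mat m n \<Longrightarrow> mat_adjoint A \<in> carrier_mat n m"
  by (auto simp: mat_adjoint_def)

lemma adjoint_dim [simp]:
  "dim_row (mat_adjoint A) = dim_col A" "dim_col (mat_adjoint A) = dim_row A"
  by (auto simp: mat_adjoint_def)

lemma adjoint_index [simp]:
  fixes A :: "complex mat"
  assumes "i < dim_col A" "j < dim_row A"
  shows "mat_adjoint A $$ (i, j) = cnj (A $$ (j, i))"
  using assms by (auto simp: mat_adjoint_def mat_of_rows_def)

lemma adjoint_adjoint [simp]: "mat_adjoint (mat_adjoint (A :: complex mat)) = A"
  by (rule eq_matI) auto

lemma index_mult_sum:
  assumes "A \<in> carrier_mat m k" "B \<in> carrier_mat k n" "i < m" "j < n"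
  shows "(A * B) $$ (i, j) = (\<Sum>l<k. A $$ (i, l) * B $$ (l, j))"
  using assms by (auto simp: scalar_prod_def atLeast0LessThan intro!: sum.cong)

lemma adjoint_mult:
  fixes A B :: "complex mat"
  assumes "A \<in> carrier_mat m k" "B \<in> carrier_mat k n"
  shows "mat_adjoint (A * B) = mat_adjoint B * mat_adjoint A"
proof (rule eq_matI)
  fix i j assume "i < dim_row (mat_adjoint B * mat_adjoint A)" "j < dim_col (mat_adjoint B * mat_adjoint A)"
  then have ij: "i < n" "j < m" using assms by auto
  have "mat_adjoint (A * B) $$ (i, j) = cnj ((A * B) $$ (j, i))"
    using ij assms by (subst adjoint_index) auto
  also have "\<dots> = (\<Sum>l<k. mat_adjoint B $$ (i, l) * mat_adjoint A $$ (l, j))"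
    using ij assms by (subst index_mult_sum[OF assms]) (auto intro!: sum.cong)
  also have "\<dots> = (mat_adjoint B * mat_adjoint A) $$ (i, j)"
    using ij assms by (subst index_mult_sum[of _ n k _ m]) auto
  finally show "mat_adjoint (A * B) $$ (i, j) = (mat_adjoint B * mat_adjoint A) $$ (i, j)" .
qed (use assms in auto)

lemma adjoint_add:
  fixes A B :: "complex mat"
  assumes "A \<in> carrier_mat m n" "B \<in> carrier_mat m n"
  shows "mat_adjoint (A + B) = mat_adjoint A + mat_adjoint B"
  using assms by (intro eq_matI) auto

lemma adjoint_smult: "mat_adjoint (c \<cdot>\<^sub>m (A :: complex mat)) = cnj c \<cdot>\<^sub>m mat_adjoint A"
  by (rule eq_matI) auto

lemma adjoint_one [simp]: "mat_adjoint (1\<^sub>m n :: complex mat) = 1\<^sub>m n"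
  by (rule eq_matI) auto

lemma adjoint_mat_diag_real [simp]:
  "mat_adjoint (mat_diag n (\<lambda>i. complex_of_real (d i))) = mat_diag n (\<lambda>i. complex_of_real (d i))"
  by (rule eq_matI) (auto simp: mat_diag_def)

lemma trace_mult_sum:
  assumes "A \<in> carrier_mat m n" "B \<in> carrier_mat n m"
  shows "mat_trace (A * B) = (\<Sum>i<m. \<Sum>j<n. A $$ (i, j) * B $$ (j, i))"
proof -
  have "dim_row (A * B) = m" using assms by auto
  then show ?thesis
    unfolding mat_trace_def by (auto intro!: sum.cong index_mult_sum[OF assms])
qed

lemma trace_cyclic:
  assumes "A \<in> carrier_mat m n" "B \<in> carrier_mat n m"
  shows "mat_trace (A * B) = mat_trace (B * A)"
  unfolding trace_mult_sum[OF assms] trace_mult_sum[OF assms(2,1)]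
  by (subst sum.swap) (simp add: mult.commute)

lemma trace_add:
  assumes "A \<in> carrier_mat n n" "B \<in> carrier_mat n n"
  shows "mat_trace (A + B) = mat_trace A + mat_trace B"
  using assms by (auto simp: mat_trace_def sum.distrib)

lemma trace_smult: "A \<in> carrier_mat n n \<Longrightarrow> mat_trace (c \<cdot>\<^sub>m A) = c * mat_trace A"
  by (auto simp: mat_trace_def sum_distrib_left)

lemma cscalar_sum:
  fixes v w :: "complex Matrix.vec"
  assumes "v \<in> carrier_vec n" "w \<in> carrier_vec n"
  shows "v \<bullet>c w = (\<Sum>i<n. v $ i * cnj (w $ i))"
  using assms by (auto simp: scalar_prod_def atLeast0LessThan)

lemma cscalar_self_pos:
  fixes v :: "complex Matrix.vec"
  assumes "v \<in> carrier_vec n" "v \<noteq> 0\<^sub>v n"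
  shows "Re (v \<bullet>c v) > 0"
proof -
  from assms obtain k where k: "k < n" "v $ k \<noteq> 0" by (metis carrier_vecD eq_vecI index_zero_vec)
  have "Re (v \<bullet>c v) = (\<Sum>i<n. (cmod (v $ i))\<^sup>2)"
    unfolding cscalar_sum[OF assms(1,1)] by (simp add: complex_norm_square[symmetric] flip: of_real_power)
  also have "\<dots> > 0" using k by (intro sum_pos2[of _ k]) auto
  finally show ?thesis .
qed

lemmas square_mat_simps =
  assoc_mult_mat[of _ n n _ n _ n] mult_carrier_mat[of _ n n _ n] adjoint_mult[of _ n n _ n]
  right_mult_one_mat[of _ n n] left_mult_one_mat[of _ n n] for n

section \<open>Unitary matrices and the spectral theorem\<close>

lemma unitary_matD:
  assumes "unitary_mat n U"
  shows "U \<in> carrier_mat n n" "mat_adjoint U * U = 1\<^sub>m n" "U * mat_adjoint U = 1\<^sub>m n"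
proof -
  show 1: "U \<in> carrier_mat n n" and 2: "mat_adjoint U * U = 1\<^sub>m n"
    using assms by (auto simp: unitary_mat_def)
  show "U * mat_adjoint U = 1\<^sub>m n"
    using mat_mult_left_right_inverse[OF _ 1 2] 1 by auto
qed

lemma unitary_mat_mult:
  assumes "unitary_mat n U" "unitary_mat n V"
  shows "unitary_mat n (U * V)"
proof -
  note U = unitary_matD[OF assms(1)] and V = unitary_matD[OF assms(2)]
  have "mat_adjoint (U * V) * (U * V) = mat_adjoint V * (mat_adjoint U * U) * V"
    using U(1) V(1) by (simp add: square_mat_simps[of _ n])
  then show ?thesis using U V by (simp add: unitary_mat_def)
qed

text \<open>Supplies one deflation step for the spectral theorem: an eigenvector, which exists
  because the characteristic polynomial splits over the complex numbers, is completed to a basis and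
  orthogonalized with itself kept as the first vector.\<close>

lemma unitary_eigenvector_column:
  fixes A :: "complex mat"
  assumes A: "A \<in> carrier_mat n n" and n: "n \<noteq> 0"
  obtains U e where "unitary_mat n U" "col (mat_adjoint U * A * U) 0 = Matrix.vec n (\<lambda>i. if i = 0 then e else 0)"
proof -
  obtain es where es: "char_poly A = (\<Prod>e\<leftarrow>es. [:- e, 1:])" "length es = n"
    using char_poly_factorized[OF A] by blast
  then obtain e es' where ees: "es = e # es'" using n by (cases es) auto
  have "eigenvalue A e" unfolding eigenvalue_root_char_poly[OF A] es(1) ees by simp
  then obtain v where ev: "eigenvector A v e" unfolding eigenvalue_def by blast
  then have v: "v \<in> carrier_vec n" "v \<noteq> 0\<^sub>v n" "A *\<^sub>v v = e \<cdot>\<^sub>v v"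
    using A by (auto simp: eigenvector_def)
  interpret cof_vec_space n "TYPE(complex)" .
  define b where "b = basis_completion v"
  define ws where "ws = gram_schmidt n b"
  from basis_completion[OF v(1,2), folded b_def]
  have b: "distinct b" "\<not> lin_dep (set b)" "set b \<subseteq> carrier_vec n" "hd b = v" "length b = n" by auto
  obtain vs where bv: "b = v # vs" using b n by (cases b) auto
  from gram_schmidt_result[OF b(3,1,2) refl, folded ws_def]
  have ws: "set ws \<subseteq> carrier_vec n" "corthogonal ws" "length ws = n" by (auto simp: b)
  from gram_schmidt_hd[OF v(1), of vs, folded bv] have hdws: "hd ws = v" unfolding ws_def .
  define c where "c i = Re (ws ! i \<bullet>c ws ! i)" for i
  \<comment> \<open>Gram-Schmidt here gives orthogonal but unnormalized vectors; \<open>c j\<close>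
    is the squared norm of the j-th one.\<close>
  define U where "U = Matrix.mat n n (\<lambda>(i, j). (ws ! j) $ i / complex_of_real (sqrt (c j)))"
  have wsi: "ws ! i \<in> carrier_vec n" if "i < n" for i using ws that by auto
  have csp: "ws ! i \<bullet>c ws ! j = (if i = j then complex_of_real (c i) else 0)" if "i < n" "j < n" for i j
  proof (cases "i = j")
    case True
    have "Im (ws ! i \<bullet>c ws ! i) = 0"
      unfolding cscalar_sum[OF wsi[OF that(1)] wsi[OF that(1)]] by simp
    then show ?thesis using True by (auto simp: c_def complex_eq_iff)
  next
    case False
    then show ?thesis using corthogonalD[OF ws(2), of i j] that ws by auto
  qed
  have cpos: "c i > 0" if "i < n" for i
  proof -
    have "ws ! i \<bullet>c ws ! i \<noteq> 0" using corthogonalD[OF ws(2), of i i] that ws by auto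
    then have "ws ! i \<noteq> 0\<^sub>v n" by auto
    then show ?thesis unfolding c_def using cscalar_self_pos wsi that by blast
  qed
  have U: "U \<in> carrier_mat n n" by (simp add: U_def)
  have sum_ws: "(\<Sum>l<n. cnj (ws ! i $ l) * ws ! j $ l) = (if i = j then complex_of_real (c i) else 0)"
    if "i < n" "j < n" for i j
    using csp[OF that(2,1)] that unfolding cscalar_sum[OF wsi[OF that(2)] wsi[OF that(1)]]
    by (simp add: mult.commute split: if_splits)
  have "mat_adjoint U * U = 1\<^sub>m n"
  proof (rule eq_matI)
    fix i j assume "i < dim_row (1\<^sub>m n :: complex mat)" "j < dim_col (1\<^sub>m n :: complex mat)"
    then have ij: "i < n" "j < n" by auto
    have "(mat_adjoint U * U) $$ (i, j) = (\<Sum>l<n. cnj (ws ! i $ l) * ws ! j $ l) / (sqrt (c i) * sqrt (c j))"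
      using ij U by (subst index_mult_sum[of _ n n _ n]) (auto simp: U_def sum_divide_distrib intro!: sum.cong)
    also have "\<dots> = (1\<^sub>m n :: complex mat) $$ (i, j)"
      using ij sum_ws[OF ij] cpos[of i] by (auto simp flip: of_real_mult)
    finally show "(mat_adjoint U * U) $$ (i, j) = (1\<^sub>m n :: complex mat) $$ (i, j)" .
  qed (use U in auto)
  then have unit: "unitary_mat n U" using U by (simp add: unitary_mat_def)
  have ws0: "ws ! 0 = v" using hdws ws n by (metis hd_conv_nth list.size(3))
  have AU: "(A * U) $$ (i, 0) = e * U $$ (i, 0)" if "i < n" for i
  proof -
    have "(A * U) $$ (i, 0) = (\<Sum>l<n. A $$ (i, l) * v $ l) / sqrt (c 0)"
      using that n A U by (subst index_mult_sum[of _ n n _ n]) (auto simp: U_def ws0 sum_divide_distrib)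
    also have "(\<Sum>l<n. A $$ (i, l) * v $ l) = (A *\<^sub>v v) $ i"
      using that A v(1) by (auto simp: scalar_prod_def atLeast0LessThan)
    also have "\<dots> = e * v $ i" using v that by simp
    finally show ?thesis using that n by (simp add: U_def ws0)
  qed
  have "col (mat_adjoint U * A * U) 0 = Matrix.vec n (\<lambda>i. if i = 0 then e else 0)"
  proof (rule eq_vecI)
    fix i assume "i < dim_vec (Matrix.vec n (\<lambda>i. if i = 0 then e else 0))"
    then have i: "i < n" by simp
    have "col (mat_adjoint U * A * U) 0 $ i = (mat_adjoint U * (A * U)) $$ (i, 0)"
      using i n U A by (auto simp: assoc_mult_mat[of _ n n _ n _ n])
    also have "\<dots> = e * (\<Sum>l<n. mat_adjoint U $$ (i, l) * U $$ (l, 0))"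
      using i n U A AU by (subst index_mult_sum[of _ n n _ n]) (auto simp: sum_distrib_left mult_ac intro!: sum.cong)
    also have "(\<Sum>l<n. mat_adjoint U $$ (i, l) * U $$ (l, 0)) = (mat_adjoint U * U) $$ (i, 0)"
      using i n U by (subst index_mult_sum[of _ n n _ n]) auto
    also have "e * \<dots> = Matrix.vec n (\<lambda>i. if i = 0 then e else 0) $ i"
      using unit i n by (simp add: unitary_mat_def)
    finally show "col (mat_adjoint U * A * U) 0 $ i = Matrix.vec n (\<lambda>i. if i = 0 then e else 0) $ i" .
  qed (use U A n in auto)
  with unit show thesis by (rule that)
qed

lemma conj_diag_carrier [simp]:
  "U \<in> carrier_mat n n \<Longrightarrow> U * mat_diag n d * mat_adjoint U \<in> carrier_mat n n"
  by (meson adjoint_carrier mat_diag_dim mult_carrier_mat)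

lemma conj_diag_index:
  fixes U :: "complex mat"
  assumes "U \<in> carrier_mat n n" "i < n" "j < n"
  shows "(U * mat_diag n d * mat_adjoint U) $$ (i, j) = (\<Sum>k<n. U $$ (i, k) * d k * cnj (U $$ (j, k)))"
  using assms
  by (subst index_mult_sum[of _ n n _ n]) (auto simp: mat_diag_mult_right[of _ n n] intro!: sum.cong)

text \<open>Once the first column of W^* A W is a multiple of the first unit vector, hermiticity
  clears the first row as well and makes the corner entry real, so the remaining block is Hermitian
  of size n and the induction applies to it.\<close>

theorem hermitian_spectral:
  assumes "hermitian_mat n A"
  shows "\<exists>U (d :: nat \<Rightarrow> real). unitary_mat n U \<and> A = U * mat_diag n (\<lambda>i. complex_of_real (d i)) * mat_adjoint U"
  using assms
proof (induction n arbitrary: A)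
  case 0
  then show ?case
    by (intro exI[of _ "1\<^sub>m 0"] exI[of _ "\<lambda>_. 0"]) (auto simp: unitary_mat_def hermitian_mat_def)
next
  case (Suc n)
  let ?N = "Suc n"
  from Suc.prems have A: "A \<in> carrier_mat ?N ?N" "mat_adjoint A = A" by (auto simp: hermitian_mat_def)
  obtain W e where W: "unitary_mat ?N W"
    and col0: "col (mat_adjoint W * A * W) 0 = Matrix.vec ?N (\<lambda>i. if i = 0 then e else 0)"
    using unitary_eigenvector_column[OF A(1)] by blast
  note Wc = unitary_matD[OF W]
  define A' where "A' = mat_adjoint W * A * W"
  have A': "A' \<in> carrier_mat ?N ?N" using A Wc by (auto simp: A'_def)
  have adjA': "mat_adjoint A' = A'"
    using A Wc(1) unfolding A'_def
    by (simp add: square_mat_simps[of _ ?N])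
  have herm: "A' $$ (i, j) = cnj (A' $$ (j, i))" if "i < ?N" "j < ?N" for i j
    using adjoint_index[of i A' j] A' adjA' that by auto
  have c0: "A' $$ (i, 0) = (if i = 0 then e else 0)" if "i < ?N" for i
    using arg_cong[OF col0[folded A'_def], of "\<lambda>v. v $ i"] that A' by auto
  have r0: "A' $$ (0, i) = (if i = 0 then e else 0)" if "i < ?N" for i
    using herm[of 0 i] c0[OF that] c0[of 0] that herm[of 0 0] by auto
  have e: "e = complex_of_real (Re e)" using herm[of 0 0] c0[of 0] by (simp add: complex_eq_iff)
  define A3 where "A3 = Matrix.mat n n (\<lambda>(i, j). A' $$ (Suc i, Suc j))"
  have "hermitian_mat n A3"
    unfolding hermitian_mat_def
  proof
    show "mat_adjoint A3 = A3"
    proof (rule eq_matI)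
      fix i j assume "i < dim_row A3" "j < dim_col A3"
      then show "mat_adjoint A3 $$ (i, j) = A3 $$ (i, j)"
        using herm[of "Suc i" "Suc j"] by (simp add: A3_def)
    qed (simp_all add: A3_def)
  qed (simp add: A3_def)
  from Suc.IH[OF this] obtain V d where V: "unitary_mat n V"
    and A3eq: "A3 = V * mat_diag n (\<lambda>i. complex_of_real (d i)) * mat_adjoint V" by blast
  note Vc = unitary_matD[OF V]
  define V' where "V' = Matrix.mat ?N ?N (\<lambda>(i, j). case i of 0 \<Rightarrow> (case j of 0 \<Rightarrow> 1 | Suc _ \<Rightarrow> 0)
       | Suc i' \<Rightarrow> (case j of 0 \<Rightarrow> 0 | Suc j' \<Rightarrow> V $$ (i', j')))"
  define d' where "d' i = (case i of 0 \<Rightarrow> Re e | Suc i' \<Rightarrow> d i')" for i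
  have V': "V' \<in> carrier_mat ?N ?N" by (simp add: V'_def)
  have "mat_adjoint V' * V' = 1\<^sub>m ?N"
  proof (rule eq_matI)
    fix i j assume "i < dim_row (1\<^sub>m ?N :: complex mat)" "j < dim_col (1\<^sub>m ?N :: complex mat)"
    then have ij: "i < ?N" "j < ?N" by auto
    have *: "(\<Sum>l<n. cnj (V $$ (l, i)) * V $$ (l, j)) = (1\<^sub>m n :: complex mat) $$ (i, j)" if "i < n" "j < n" for i j
      unfolding Vc(2)[symmetric] using that Vc(1) by (subst index_mult_sum[of _ n n _ n]) auto
    show "(mat_adjoint V' * V') $$ (i, j) = (1\<^sub>m ?N :: complex mat) $$ (i, j)"
      using ij V' *
      by (subst index_mult_sum[of _ ?N ?N _ ?N])
        (auto simp: V'_def sum.lessThan_Suc_shift simp del: sum.lessThan_Suc split: nat.splits)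
  qed (use V' in auto)
  then have uV': "unitary_mat ?N V'" using V' by (simp add: unitary_mat_def)
  have A'eq: "A' = V' * mat_diag ?N (\<lambda>i. complex_of_real (d' i)) * mat_adjoint V'"
  proof (rule eq_matI)
    fix i j
    assume "i < dim_row (V' * mat_diag ?N (\<lambda>i. complex_of_real (d' i)) * mat_adjoint V')"
      "j < dim_col (V' * mat_diag ?N (\<lambda>i. complex_of_real (d' i)) * mat_adjoint V')"
    then have ij: "i < ?N" "j < ?N" using V' by auto
    have *: "(\<Sum>k<n. V $$ (i, k) * d k * cnj (V $$ (j, k))) = A' $$ (Suc i, Suc j)" if "i < n" "j < n" for i j
      using arg_cong[OF A3eq, of "\<lambda>M. M $$ (i, j)"] that conj_diag_index[OF Vc(1) that, of d]
      by (simp add: A3_def)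
    show "A' $$ (i, j) = (V' * mat_diag ?N (\<lambda>i. complex_of_real (d' i)) * mat_adjoint V') $$ (i, j)"
      unfolding conj_diag_index[OF V' ij]
      using ij * c0 r0 e
      by (auto simp: V'_def d'_def sum.lessThan_Suc_shift simp del: sum.lessThan_Suc split: nat.splits)
  qed (use V' A' in auto)
  have "A = W * A' * mat_adjoint W"
  proof -
    have "W * A' * mat_adjoint W = (W * mat_adjoint W) * A * (W * mat_adjoint W)"
      using A Wc(1) by (simp add: A'_def square_mat_simps[of _ ?N])
    then show ?thesis using A Wc by simp
  qed
  also have "\<dots> = (W * V') * mat_diag ?N (\<lambda>i. complex_of_real (d' i)) * mat_adjoint (W * V')"
    unfolding A'eq using V' Wc(1) mat_diag_dim[of ?N]
    by (simp add: square_mat_simps[of _ ?N])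
  finally show ?case using unitary_mat_mult[OF W uV'] by blast
qed

section \<open>Functional calculus\<close>

definition eigen_decomp :: "nat \<Rightarrow> complex mat \<Rightarrow> complex mat \<Rightarrow> (nat \<Rightarrow> real) \<Rightarrow> bool" where
  "eigen_decomp n A U d \<longleftrightarrow>
     unitary_mat n U \<and> A = U * mat_diag n (\<lambda>i. complex_of_real (d i)) * mat_adjoint U"

lemma unitary_cancel:
  assumes "unitary_mat n U" "X \<in> carrier_mat n n"
  shows "mat_adjoint U * (U * X) = X" "U * (mat_adjoint U * X) = X"
  using unitary_matD[OF assms(1)] assms(2)
  by (simp_all flip: assoc_mult_mat[of _ n n _ n _ n])

text \<open>\<open>mat_fun\<close> picks a matrix arising from some diagonalization, so independence
  of that choice has to be shown. For two diagonalizations, W = V^* U intertwines the diagonal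
  matrices; an entry W_ij can be nonzero only if d_j = e_i, hence W intertwines the images under f
  as well.\<close>

lemma mat_fun_eigen_decomp:
  assumes "eigen_decomp n A U d"
  shows "mat_fun f A = U * mat_diag n (\<lambda>i. complex_of_real (f (d i))) * mat_adjoint U"
proof -
  let ?D = "\<lambda>d. mat_diag n (\<lambda>i. complex_of_real (d i))"
  have U: "unitary_mat n U" and A: "A = U * ?D d * mat_adjoint U"
    using assms by (auto simp: eigen_decomp_def)
  have Uc: "U \<in> carrier_mat n n" using U by (simp add: unitary_mat_def)
  have dim: "dim_row A = n" using Uc by (simp add: A)
  have unique: "V * ?D (\<lambda>i. f (e i)) * mat_adjoint V = U * ?D (\<lambda>i. f (d i)) * mat_adjoint U"
    if V: "unitary_mat n V" and AV: "A = V * ?D e * mat_adjoint V" for V and e :: "nat \<Rightarrow> real"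
  proof -
    have Vc: "V \<in> carrier_mat n n" using V by (simp add: unitary_mat_def)
    define W where "W = mat_adjoint V * U"
    have W: "W \<in> carrier_mat n n" using Uc Vc by (auto simp: W_def)
    have "W * ?D d = mat_adjoint V * (U * ?D d * mat_adjoint U) * U"
      using U Uc Vc unitary_matD[OF U] by (simp add: W_def square_mat_simps[of _ n])
    also have "\<dots> = mat_adjoint V * (V * ?D e * mat_adjoint V) * U" using A AV by simp
    also have "\<dots> = ?D e * W"
      using V Uc Vc by (simp add: W_def square_mat_simps[of _ n] unitary_cancel[of n])
    finally have comm: "W * ?D d = ?D e * W" .
    have entry: "W $$ (i, j) * d j = e i * W $$ (i, j)" if "i < n" "j < n" for i j
      using arg_cong[OF comm, of "\<lambda>M. M $$ (i, j)"] that
      by (simp add: mat_diag_mult_left[OF W] mat_diag_mult_right[OF W])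
    have entry': "W $$ (i, j) * f (d j) = f (e i) * W $$ (i, j)" if "i < n" "j < n" for i j
    proof (cases "W $$ (i, j) = 0")
      case False
      then have "complex_of_real (d j) = complex_of_real (e i)" using entry[OF that] by simp
      then show ?thesis by simp
    qed simp
    have comm': "W * ?D (\<lambda>i. f (d i)) = ?D (\<lambda>i. f (e i)) * W"
      unfolding mat_diag_mult_left[OF W] mat_diag_mult_right[OF W]
      using entry' by (intro eq_matI) auto
    have "U * ?D (\<lambda>i. f (d i)) * mat_adjoint U = V * (W * ?D (\<lambda>i. f (d i))) * mat_adjoint U"
      using V Uc Vc by (simp add: W_def square_mat_simps[of _ n] unitary_cancel[of n])
    also have "\<dots> = V * ?D (\<lambda>i. f (e i)) * mat_adjoint V"
      unfolding comm' using unitary_matD[OF U] Vc by (simp add: W_def square_mat_simps[of _ n])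
    finally show ?thesis by simp
  qed
  show ?thesis
    unfolding mat_fun_def dim
    by (rule someI2[where a = "U * ?D (\<lambda>i. f (d i)) * mat_adjoint U"]) (use U A unique in blast)+
qed

lemma eigen_decomp_mat_fun:
  assumes "eigen_decomp n A U d"
  shows "eigen_decomp n (mat_fun f A) U (\<lambda>i. f (d i))"
  using assms mat_fun_eigen_decomp[OF assms] by (simp add: eigen_decomp_def)

lemma eigen_decomp_hermitian:
  assumes "eigen_decomp n A U d"
  shows "hermitian_mat n A"
  using assms by (auto simp: eigen_decomp_def hermitian_mat_def unitary_mat_def square_mat_simps[of _ n])

text \<open>One diagonalization per matrix is fixed by choice, so that spectral double sums become
  functions of the matrices. The eigenvalues are chosen relative to the eigenvectors, which keeps
  the two compatible.\<close>

definition eig_vecs :: "complex mat \<Rightarrow> complex mat" where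
  "eig_vecs A = (SOME U. \<exists>d. eigen_decomp (dim_row A) A U d)"

definition eig_vals :: "complex mat \<Rightarrow> nat \<Rightarrow> real" where
  "eig_vals A = (SOME d. eigen_decomp (dim_row A) A (eig_vecs A) d)"

lemma eigen_decomp_eig:
  assumes "hermitian_mat n A"
  shows "eigen_decomp n A (eig_vecs A) (eig_vals A)"
proof -
  have dim: "dim_row A = n" using assms by (auto simp: hermitian_mat_def)
  have "\<exists>U d. eigen_decomp n A U d"
    using hermitian_spectral[OF assms] by (simp add: eigen_decomp_def)
  then have "\<exists>d. eigen_decomp n A (eig_vecs A) d" unfolding eig_vecs_def dim by (rule someI_ex)
  then show ?thesis unfolding eig_vals_def dim by (rule someI_ex)
qed

lemma eig_vecs_carrier: "hermitian_mat n A \<Longrightarrow> eig_vecs A \<in> carrier_mat n n"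
  using eigen_decomp_eig by (auto simp: eigen_decomp_def unitary_mat_def)

lemma hermitian_carrier: "hermitian_mat n A \<Longrightarrow> A \<in> carrier_mat n n"
  by (simp add: hermitian_mat_def)

lemma hermitian_mat_fun: "hermitian_mat n A \<Longrightarrow> hermitian_mat n (mat_fun f A)"
  using eigen_decomp_eig eigen_decomp_mat_fun eigen_decomp_hermitian by blast

lemma mat_fun_carrier: "hermitian_mat n A \<Longrightarrow> mat_fun f A \<in> carrier_mat n n"
  using hermitian_mat_fun hermitian_carrier by blast

lemma mat_fun_comp: "hermitian_mat n A \<Longrightarrow> mat_fun f (mat_fun g A) = mat_fun (\<lambda>x. f (g x)) A"
  using mat_fun_eigen_decomp[OF eigen_decomp_mat_fun[OF eigen_decomp_eig]]
  by (simp add: mat_fun_eigen_decomp[OF eigen_decomp_eig])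

lemma mat_fun_cong:
  assumes "hermitian_mat n A" "\<And>i. i < n \<Longrightarrow> f (eig_vals A i) = g (eig_vals A i)"
  shows "mat_fun f A = mat_fun g A"
proof -
  have "mat_diag n (\<lambda>i. complex_of_real (f (eig_vals A i))) = mat_diag n (\<lambda>i. complex_of_real (g (eig_vals A i)))"
    using assms(2) by (intro eq_matI) (auto simp: mat_diag_def)
  then show ?thesis
    unfolding mat_fun_eigen_decomp[OF eigen_decomp_eig[OF assms(1)]] by simp
qed

lemma mat_fun_ident: "hermitian_mat n A \<Longrightarrow> mat_fun (\<lambda>x. x) A = A"
  using eigen_decomp_eig[of n A] mat_fun_eigen_decomp[OF eigen_decomp_eig[of n A], of "\<lambda>x. x"]
  by (simp add: eigen_decomp_def)

lemma mat_fun_one: "hermitian_mat n A \<Longrightarrow> mat_fun (\<lambda>x. 1) A = 1\<^sub>m n"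
  using mat_fun_eigen_decomp[OF eigen_decomp_eig[of n A], of "\<lambda>x. 1"]
    unitary_matD[of n "eig_vecs A"] eigen_decomp_eig[of n A]
  by (simp add: eigen_decomp_def)

lemma hermitian_one: "hermitian_mat n (1\<^sub>m n)"
  by (simp add: hermitian_mat_def)

lemma mat_fun_mult:
  assumes "hermitian_mat n A"
  shows "mat_fun f A * mat_fun g A = mat_fun (\<lambda>x. f x * g x) A"
proof -
  have U: "unitary_mat n (eig_vecs A)"
    using eigen_decomp_eig[OF assms] by (simp add: eigen_decomp_def)
  show ?thesis
    unfolding mat_fun_eigen_decomp[OF eigen_decomp_eig[OF assms]]
    using eig_vecs_carrier[OF assms] mat_diag_dim[of n]
    by (simp add: square_mat_simps[of _ n] unitary_cancel[OF U])
      (simp flip: assoc_mult_mat[of _ n n _ n _ n])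
qed

text \<open>The eigenvalues come from a choice operator, so even those of the identity have to be
  computed. This permits setting one variable of a jointly convex function to the identity.\<close>

lemma eig_vals_one:
  assumes "i < n"
  shows "eig_vals (1\<^sub>m n) i = 1"
proof -
  let ?U = "eig_vecs (1\<^sub>m n)" and ?D = "mat_diag n (\<lambda>i. complex_of_real (eig_vals (1\<^sub>m n) i))"
  have d: "eigen_decomp n (1\<^sub>m n) ?U (eig_vals (1\<^sub>m n))" by (rule eigen_decomp_eig[OF hermitian_one])
  then have U: "unitary_mat n ?U" and eq: "1\<^sub>m n = ?U * ?D * mat_adjoint ?U"
    by (simp_all add: eigen_decomp_def)
  note Uc = unitary_matD[OF U]
  have "?D = mat_adjoint ?U * (?U * ?D * mat_adjoint ?U) * ?U"
    using Uc by (simp add: square_mat_simps[of _ n] unitary_cancel[OF U])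
  also have "\<dots> = 1\<^sub>m n" unfolding eq[symmetric] using Uc by (simp add: square_mat_simps[of _ n])
  finally have "?D $$ (i, i) = 1" using assms by simp
  then show ?thesis using assms by (simp add: mat_diag_def)
qed

section \<open>Positivity\<close>

lemma cscalar_adjoint:
  fixes M :: "complex mat"
  assumes M: "M \<in> carrier_mat m n" and v: "v \<in> carrier_vec n" and w: "w \<in> carrier_vec m"
  shows "(M *\<^sub>v v) \<bullet>c w = v \<bullet>c (mat_adjoint M *\<^sub>v w)"
proof -
  have 1: "(M *\<^sub>v v) $ i = (\<Sum>j<n. M $$ (i, j) * v $ j)" if "i < m" for i
    using that M v by (auto simp: scalar_prod_def atLeast0LessThan intro!: sum.cong)
  have 2: "(mat_adjoint M *\<^sub>v w) $ j = (\<Sum>i<m. cnj (M $$ (i, j)) * w $ i)" if "j < n" for j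
    using that M w by (auto simp: scalar_prod_def atLeast0LessThan intro!: sum.cong)
  have "(M *\<^sub>v v) \<bullet>c w = (\<Sum>i<m. \<Sum>j<n. M $$ (i, j) * v $ j * cnj (w $ i))"
    using M v w by (subst cscalar_sum[of _ m]) (auto simp: 1 sum_distrib_right simp del: index_mult_mat_vec)
  also have "\<dots> = (\<Sum>j<n. \<Sum>i<m. M $$ (i, j) * v $ j * cnj (w $ i))" by (rule sum.swap)
  also have "\<dots> = v \<bullet>c (mat_adjoint M *\<^sub>v w)"
    using v mult_mat_vec_carrier[OF adjoint_carrier[OF M] w]
    by (subst cscalar_sum[of _ n]) (auto simp: 2 sum_distrib_left mult_ac simp del: index_mult_mat_vec)
  finally show ?thesis .
qed

lemma qform_congruence:
  assumes "H \<in> carrier_mat m n" "C \<in> carrier_mat m m" "v \<in> carrier_vec n"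
  shows "qform (mat_adjoint H * C * H) v = qform C (H *\<^sub>v v)"
proof -
  have "mat_adjoint H * C * H *\<^sub>v v = mat_adjoint H * C *\<^sub>v (H *\<^sub>v v)"
    by (rule assoc_mult_mat_vec[of _ n m _ n]) (use assms in auto)
  also have "\<dots> = mat_adjoint H *\<^sub>v (C *\<^sub>v (H *\<^sub>v v))"
    by (rule assoc_mult_mat_vec[of _ n m _ m]) (use assms in auto)
  finally have "mat_adjoint H * C * H *\<^sub>v v = mat_adjoint H *\<^sub>v (C *\<^sub>v (H *\<^sub>v v))" .
  then show ?thesis
    using assms cscalar_adjoint[of "mat_adjoint H" n m "C *\<^sub>v (H *\<^sub>v v)" v] by (simp add: qform_def)
qed

lemma qform_add:
  assumes "A \<in> carrier_mat n n" "B \<in> carrier_mat n n" "v \<in> carrier_vec n"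
  shows "qform (A + B) v = qform A v + qform B v"
  using assms unfolding qform_def
  by (simp add: add_mult_distrib_mat_vec[of _ n n] add_scalar_prod_distrib[of _ n])

lemma qform_smult:
  assumes "A \<in> carrier_mat n n" "v \<in> carrier_vec n"
  shows "qform (c \<cdot>\<^sub>m A) v = c * qform A v"
proof -
  have "c \<cdot>\<^sub>m A *\<^sub>v v = c \<cdot>\<^sub>v (A *\<^sub>v v)" using assms by (intro eq_vecI) auto
  then show ?thesis using assms by (simp add: qform_def)
qed

lemma qform_one: "v \<in> carrier_vec n \<Longrightarrow> qform (1\<^sub>m n) v = v \<bullet>c v"
  by (simp add: qform_def)

lemma qform_diag:
  assumes "v \<in> carrier_vec n"
  shows "Re (qform (mat_diag n (\<lambda>i. complex_of_real (d i))) v) = (\<Sum>i<n. d i * (cmod (v $ i))\<^sup>2)"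
proof -
  let ?D = "mat_diag n (\<lambda>i. complex_of_real (d i))"
  have c: "?D *\<^sub>v v \<in> carrier_vec n"
    using assms mult_mat_vec_carrier[OF mat_diag_dim] by blast
  have entry: "(?D *\<^sub>v v) $ i = d i * v $ i" if "i < n" for i
    using that assms
    by (auto simp: scalar_prod_def mat_diag_def sum.If_cases if_distrib[where f = "\<lambda>x. x * _"] cong: if_cong)
  have "qform ?D v = (\<Sum>i<n. complex_of_real (d i * (cmod (v $ i))\<^sup>2))"
    unfolding qform_def cscalar_sum[OF c assms]
    by (intro sum.cong refl) (simp only: lessThan_iff entry of_real_mult complex_norm_square mult.assoc)
  then show ?thesis by simp
qed

lemma qform_eigen_decomp:
  assumes "eigen_decomp n A U d" "v \<in> carrier_vec n"
  shows "Re (qform A v) = (\<Sum>i<n. d i * (cmod ((mat_adjoint U *\<^sub>v v) $ i))\<^sup>2)"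
proof -
  have U: "U \<in> carrier_mat n n" and A: "A = U * mat_diag n (\<lambda>i. complex_of_real (d i)) * mat_adjoint U"
    using assms by (auto simp: eigen_decomp_def unitary_mat_def)
  show ?thesis
    unfolding A using qform_congruence[of "mat_adjoint U" n n "mat_diag n (\<lambda>i. complex_of_real (d i))" v] U assms(2)
    by (simp add: qform_diag[of _ n] mult_mat_vec_carrier[of _ n n] del: index_mult_mat_vec)
qed

lemma eigen_decomp_qform_col:
  assumes "eigen_decomp n A U d" "i < n"
  shows "Re (qform A (col U i)) = d i"
proof -
  have U: "U \<in> carrier_mat n n" "mat_adjoint U * U = 1\<^sub>m n"
    using assms by (auto simp: eigen_decomp_def unitary_mat_def)
  have "mat_adjoint U *\<^sub>v col U i = col (mat_adjoint U * U) i"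
    using U(1) assms(2) by auto
  also have "\<dots> = unit_vec n i" using U(2) assms(2) by simp
  finally have unit: "mat_adjoint U *\<^sub>v col U i = unit_vec n i" .
  have "Re (qform A (col U i)) = (\<Sum>j<n. d j * (cmod (unit_vec n i $ j))\<^sup>2)"
    using qform_eigen_decomp[OF assms(1), of "col U i"] U(1) assms(2) unfolding unit by auto
  also have "\<dots> = (\<Sum>j<n. if j = i then d i else 0)"
    using assms(2) by (intro sum.cong) auto
  finally show ?thesis using assms(2) by simp
qed

lemma pos_def_eigen_decomp_iff:
  assumes "eigen_decomp n A U d"
  shows "pos_def_mat n A \<longleftrightarrow> (\<forall>i<n. d i > 0)"
proof
  assume pd: "pos_def_mat n A"
  show "\<forall>i<n. d i > 0"
  proof (intro allI impI)
    fix i assume i: "i < n"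
    have U: "U \<in> carrier_mat n n" "mat_adjoint U * U = 1\<^sub>m n"
      using assms by (auto simp: eigen_decomp_def unitary_mat_def)
    have "mat_adjoint U *\<^sub>v col U i = col (mat_adjoint U * U) i" using U(1) i by auto
    then have unit: "mat_adjoint U *\<^sub>v col U i = unit_vec n i" using U(2) i by simp
    have "col U i \<noteq> 0\<^sub>v n"
    proof
      assume "col U i = 0\<^sub>v n"
      then have "(mat_adjoint U *\<^sub>v col U i) $ i = 0" using U(1) i by simp
      with unit show False using i by simp
    qed
    then show "d i > 0"
      using pd i U(1) eigen_decomp_qform_col[OF assms i] by (auto simp: pos_def_mat_def)
  qed
next
  assume d: "\<forall>i<n. d i > 0"
  have U: "U \<in> carrier_mat n n" "U * mat_adjoint U = 1\<^sub>m n"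
    using assms unitary_matD by (auto simp: eigen_decomp_def)
  have "Re (qform A v) > 0" if v: "v \<in> carrier_vec n" "v \<noteq> 0\<^sub>v n" for v
  proof -
    let ?w = "mat_adjoint U *\<^sub>v v"
    have "U *\<^sub>v ?w = v" using U v by (simp flip: assoc_mult_mat_vec[of _ n n _ n])
    moreover have "U *\<^sub>v 0\<^sub>v n = 0\<^sub>v n" using U(1) by (intro eq_vecI) auto
    ultimately have "?w \<noteq> 0\<^sub>v n" using v(2) by metis
    moreover have "?w \<in> carrier_vec n" using adjoint_carrier[OF U(1)] v(1) by (rule mult_mat_vec_carrier)
    ultimately obtain k where k: "k < n" "?w $ k \<noteq> 0" by (metis carrier_vecD eq_vecI index_zero_vec)
    have "(\<Sum>i<n. d i * (cmod (?w $ i))\<^sup>2) > 0"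
      using k d by (intro sum_pos2[of _ k]) (auto simp: less_imp_le)
    then show ?thesis using qform_eigen_decomp[OF assms v(1)] by simp
  qed
  then show "pos_def_mat n A"
    using eigen_decomp_hermitian[OF assms] by (simp add: pos_def_mat_def)
qed

lemma pos_defD:
  assumes "pos_def_mat n A"
  shows "hermitian_mat n A" "i < n \<Longrightarrow> eig_vals A i > 0" "pos_semidef_mat n A" "A \<in> carrier_mat n n"
proof -
  show h: "hermitian_mat n A" using assms by (simp add: pos_def_mat_def)
  then show "i < n \<Longrightarrow> eig_vals A i > 0" "A \<in> carrier_mat n n"
    using assms pos_def_eigen_decomp_iff[OF eigen_decomp_eig] by (auto simp: hermitian_mat_def)
  have "Re (qform A v) \<ge> 0" if "v \<in> carrier_vec n" for v
  proof (cases "v = 0\<^sub>v n")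
    case True
    have "A *\<^sub>v v \<in> carrier_vec n"
      by (rule mult_mat_vec_carrier[of _ n n]) (use h that in \<open>auto simp: hermitian_mat_def\<close>)
    then show ?thesis using True by (simp add: qform_def cscalar_sum[of _ n] del: index_mult_mat_vec)
  qed (use assms that in \<open>auto simp: pos_def_mat_def less_imp_le\<close>)
  then show "pos_semidef_mat n A" using h by (simp add: pos_semidef_mat_def)
qed

lemma pos_def_mat_fun:
  assumes "hermitian_mat n A" "\<And>i. i < n \<Longrightarrow> f (eig_vals A i) > 0"
  shows "pos_def_mat n (mat_fun f A)"
  using pos_def_eigen_decomp_iff[OF eigen_decomp_mat_fun[OF eigen_decomp_eig[OF assms(1)]]] assms(2)
  by blast

lemma pos_def_one: "pos_def_mat n (1\<^sub>m n)"
  by (auto simp: pos_def_mat_def hermitian_one qform_one cscalar_self_pos)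

text \<open>Taking K to be the Hermitian square root makes both orders of the product equal to M.
  This is how a positive semidefinite weight becomes the middle factor of a spectral double
  sum.\<close>

lemma pos_semidef_sqrt:
  assumes "pos_semidef_mat n M"
  obtains K where "K \<in> carrier_mat n n" "M = mat_adjoint K * K" "M = K * mat_adjoint K"
proof
  let ?K = "mat_fun sqrt M"
  have h: "hermitian_mat n M" using assms by (simp add: pos_semidef_mat_def)
  have d: "eig_vals M i \<ge> 0" if "i < n" for i
  proof -
    have "col (eig_vecs M) i \<in> carrier_vec n"
      using eig_vecs_carrier[OF h] by (intro carrier_vecI) auto
    then show ?thesis
      using eigen_decomp_qform_col[OF eigen_decomp_eig[OF h] that] assms
      by (auto simp: pos_semidef_mat_def)
  qed
  show "?K \<in> carrier_mat n n" using h by (rule mat_fun_carrier)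
  have adj: "mat_adjoint ?K = ?K" using hermitian_mat_fun[OF h] by (simp add: hermitian_mat_def)
  have "?K * ?K = mat_fun (\<lambda>x. x) M"
    unfolding mat_fun_mult[OF h] using d by (intro mat_fun_cong[OF h]) simp
  then show "M = mat_adjoint ?K * ?K" "M = ?K * mat_adjoint ?K"
    using mat_fun_ident[OF h] adj by simp_all
qed

lemma hermitian_comb:
  assumes "hermitian_mat n A" "hermitian_mat n B"
  shows "hermitian_mat n (complex_of_real s \<cdot>\<^sub>m A + complex_of_real t \<cdot>\<^sub>m B)"
  using assms by (auto simp: hermitian_mat_def adjoint_add[of _ n n] adjoint_smult)

lemma pos_def_comb:
  assumes "pos_def_mat n A" "pos_def_mat n B" "0 \<le> t" "t \<le> (1 :: real)"
  shows "pos_def_mat n (complex_of_real t \<cdot>\<^sub>m A + complex_of_real (1 - t) \<cdot>\<^sub>m B)"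
  unfolding pos_def_mat_def
proof (intro conjI ballI impI)
  note A = pos_defD[OF assms(1)] and B = pos_defD[OF assms(2)]
  show "hermitian_mat n (complex_of_real t \<cdot>\<^sub>m A + complex_of_real (1 - t) \<cdot>\<^sub>m B)"
    using A(1) B(1) by (rule hermitian_comb)
  fix v :: "complex Matrix.vec" assume v: "v \<in> carrier_vec n" "v \<noteq> 0\<^sub>v n"
  have pos: "Re (qform A v) > 0" "Re (qform B v) > 0"
    using assms(1,2) v by (auto simp: pos_def_mat_def)
  have "Re (qform (complex_of_real t \<cdot>\<^sub>m A + complex_of_real (1 - t) \<cdot>\<^sub>m B) v)
      = t * Re (qform A v) + (1 - t) * Re (qform B v)"
    using A(4) B(4) v by (simp add: qform_add[of _ n] qform_smult[of _ n])
  also have "\<dots> > 0"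
    using pos assms(3,4) by (cases "t = 0") (auto intro: add_pos_nonneg)
  finally show "Re (qform (complex_of_real t \<cdot>\<^sub>m A + complex_of_real (1 - t) \<cdot>\<^sub>m B) v) > 0" .
qed

section \<open>Spectral double sums and Klein's inequality\<close>

definition rtr :: "complex mat \<Rightarrow> real" where
  "rtr A = Re (mat_trace A)"

lemma rtr_cyclic: "A \<in> carrier_mat m n \<Longrightarrow> B \<in> carrier_mat n m \<Longrightarrow> rtr (A * B) = rtr (B * A)"
  by (simp add: rtr_def trace_cyclic)

lemma rtr_add: "A \<in> carrier_mat n n \<Longrightarrow> B \<in> carrier_mat n n \<Longrightarrow> rtr (A + B) = rtr A + rtr B"
  by (simp add: rtr_def trace_add)

lemma rtr_smult: "A \<in> carrier_mat n n \<Longrightarrow> rtr (complex_of_real c \<cdot>\<^sub>m A) = c * rtr A"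
  by (simp add: rtr_def trace_smult)

definition eig_overlap :: "complex mat \<Rightarrow> complex mat \<Rightarrow> complex mat \<Rightarrow> complex mat" where
  "eig_overlap A B K = mat_adjoint (eig_vecs A) * K * eig_vecs B"

lemma eig_overlap_carrier:
  assumes "hermitian_mat n A" "hermitian_mat n B" "K \<in> carrier_mat n n"
  shows "eig_overlap A B K \<in> carrier_mat n n"
  using assms eig_vecs_carrier[of n A] eig_vecs_carrier[of n B]
  by (simp add: eig_overlap_def square_mat_simps[of _ n])

text \<open>Two middle factors K and X are allowed because the variational argument for the quotient
  kernel needs the sesquilinear form, not only its diagonal.\<close>

lemma trace_eig_overlap:
  assumes A: "hermitian_mat n A" and B: "hermitian_mat n B"
    and K: "K \<in> carrier_mat n n" and X: "X \<in> carrier_mat n n"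
  shows "mat_trace (mat_fun f A * K * mat_fun h B * mat_adjoint X) =
    (\<Sum>i<n. \<Sum>j<n. f (eig_vals A i) * h (eig_vals B j) *
      (eig_overlap A B K $$ (i, j) * cnj (eig_overlap A B X $$ (i, j))))"
proof -
  let ?U = "eig_vecs A" and ?V = "eig_vecs B"
  let ?F = "mat_diag n (\<lambda>i. complex_of_real (f (eig_vals A i)))"
  let ?G = "mat_diag n (\<lambda>i. complex_of_real (h (eig_vals B i)))"
  note U = eig_vecs_carrier[OF A] and V = eig_vecs_carrier[OF B]
  note K' = eig_overlap_carrier[OF A B K] and X' = eig_overlap_carrier[OF A B X]
  have "mat_trace (mat_fun f A * K * mat_fun h B * mat_adjoint X) =
      mat_trace (?U * (?F * eig_overlap A B K * ?G * mat_adjoint ?V * mat_adjoint X))"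
    unfolding mat_fun_eigen_decomp[OF eigen_decomp_eig[OF A]] mat_fun_eigen_decomp[OF eigen_decomp_eig[OF B]]
    using U V K X by (simp add: eig_overlap_def square_mat_simps[of _ n])
  also have "\<dots> = mat_trace ((?F * eig_overlap A B K * ?G) * mat_adjoint (eig_overlap A B X))"
    by (subst trace_cyclic[of _ n n])
      (use U V K X in \<open>auto simp: eig_overlap_def square_mat_simps[of _ n]\<close>)
  also have "\<dots> = (\<Sum>i<n. \<Sum>j<n. (?F * eig_overlap A B K * ?G) $$ (i, j) * mat_adjoint (eig_overlap A B X) $$ (j, i))"
    by (rule trace_mult_sum) (use K' X' in \<open>simp_all add: square_mat_simps[of _ n]\<close>)
  also have "\<dots> = (\<Sum>i<n. \<Sum>j<n. f (eig_vals A i) * h (eig_vals B j) *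
      (eig_overlap A B K $$ (i, j) * cnj (eig_overlap A B X $$ (i, j))))"
  proof (intro sum.cong refl)
    fix i j assume "i \<in> {..<n}" "j \<in> {..<n}"
    then have ij: "i < n" "j < n" by auto
    have "(?F * eig_overlap A B K * ?G) $$ (i, j) = f (eig_vals A i) * eig_overlap A B K $$ (i, j) * h (eig_vals B j)"
      using ij K' by (subst mat_diag_mult_right[of _ n]) (auto simp: mat_diag_mult_left[of _ n n])
    then show "(?F * eig_overlap A B K * ?G) $$ (i, j) * mat_adjoint (eig_overlap A B X) $$ (j, i)
      = f (eig_vals A i) * h (eig_vals B j) * (eig_overlap A B K $$ (i, j) * cnj (eig_overlap A B X $$ (i, j)))"
      using ij X' by simp
  qed
  finally show ?thesis by simp
qed

text \<open>This is the quadratic form at K of \<phi>(L_A, R_B), where L_A and R_B are the commuting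
  operators of left multiplication by A and right multiplication by B. The spectral definition
  admits kernels that are not finite sums of products.\<close>

definition bispec :: "(real \<Rightarrow> real \<Rightarrow> real) \<Rightarrow> complex mat \<Rightarrow> complex mat \<Rightarrow> complex mat \<Rightarrow> real" where
  "bispec \<phi> A B K = (\<Sum>i<dim_row A. \<Sum>j<dim_row B.
     \<phi> (eig_vals A i) (eig_vals B j) * (cmod (eig_overlap A B K $$ (i, j)))\<^sup>2)"

lemma bispec_eq:
  assumes "hermitian_mat n A" "hermitian_mat n B"
  shows "bispec \<phi> A B K = (\<Sum>i<n. \<Sum>j<n.
     \<phi> (eig_vals A i) (eig_vals B j) * (cmod (eig_overlap A B K $$ (i, j)))\<^sup>2)"
  using assms by (auto simp: bispec_def hermitian_mat_def)

lemma bispec_prod: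
  assumes "hermitian_mat n A" "hermitian_mat n B" "K \<in> carrier_mat n n"
  shows "bispec (\<lambda>x y. f x * h y) A B K = rtr (mat_fun f A * K * mat_fun h B * mat_adjoint K)"
  unfolding rtr_def trace_eig_overlap[OF assms assms(3)] bispec_eq[OF assms(1,2)]
  by (simp add: cmod_power2) (simp add: power2_eq_square)

lemma bispec_left:
  assumes "hermitian_mat n A" "hermitian_mat n B" "K \<in> carrier_mat n n"
  shows "bispec (\<lambda>x y. f x) A B K = rtr (mat_fun f A * (K * mat_adjoint K))"
  using bispec_prod[OF assms, of f "\<lambda>_. 1"] assms mat_fun_carrier[OF assms(1)]
  by (simp add: mat_fun_one square_mat_simps[of _ n])

lemma bispec_right:
  assumes "hermitian_mat n A" "hermitian_mat n B" "K \<in> carrier_mat n n"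
  shows "bispec (\<lambda>x y. h y) A B K = rtr (mat_fun h B * (mat_adjoint K * K))"
proof -
  have "bispec (\<lambda>x y. h y) A B K = rtr (K * (mat_fun h B * mat_adjoint K))"
    using bispec_prod[OF assms, of "\<lambda>_. 1" h] assms mat_fun_carrier[OF assms(2)]
    by (simp add: mat_fun_one square_mat_simps[of _ n])
  also have "\<dots> = rtr (mat_fun h B * (mat_adjoint K * K))"
    using assms mat_fun_carrier[OF assms(2)]
    by (subst rtr_cyclic[of _ n n]) (auto simp: square_mat_simps[of _ n])
  finally show ?thesis .
qed

section \<open>Order, linearity and symmetry of the double sum\<close>

lemma bispec_mono:
  assumes "hermitian_mat n A" "hermitian_mat n B"
    and "\<And>i j. i < n \<Longrightarrow> j < n \<Longrightarrow> \<phi> (eig_vals A i) (eig_vals B j) \<le> \<psi> (eig_vals A i) (eig_vals B j)"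
  shows "bispec \<phi> A B K \<le> bispec \<psi> A B K"
  unfolding bispec_eq[OF assms(1,2)] by (intro sum_mono mult_right_mono assms(3)) auto

lemma bispec_cong:
  assumes "hermitian_mat n A" "hermitian_mat n B"
    and "\<And>i j. i < n \<Longrightarrow> j < n \<Longrightarrow> \<phi> (eig_vals A i) (eig_vals B j) = \<psi> (eig_vals A i) (eig_vals B j)"
  shows "bispec \<phi> A B K = bispec \<psi> A B K"
  unfolding bispec_eq[OF assms(1,2)] by (intro sum.cong refl) (simp add: assms(3))

lemma bispec_add: "bispec (\<lambda>x y. \<phi> x y + \<psi> x y) A B K = bispec \<phi> A B K + bispec \<psi> A B K"
  by (simp add: bispec_def distrib_right sum.distrib)

lemma bispec_cmult: "bispec (\<lambda>x y. c * \<phi> x y) A B K = c * bispec \<phi> A B K"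
  by (simp add: bispec_def sum_distrib_left mult_ac)

lemma bispec_swap:
  assumes A: "hermitian_mat n A" and B: "hermitian_mat n B" and K: "K \<in> carrier_mat n n"
  shows "bispec (\<lambda>x y. \<phi> y x) A B K = bispec \<phi> B A (mat_adjoint K)"
proof -
  have "eig_overlap B A (mat_adjoint K) = mat_adjoint (eig_overlap A B K)"
    using eig_vecs_carrier[OF A] eig_vecs_carrier[OF B] K
    by (simp add: eig_overlap_def square_mat_simps[of _ n])
  then show ?thesis
    unfolding bispec_eq[OF A B] bispec_eq[OF B A] using eig_overlap_carrier[OF assms]
    by (subst sum.swap) (auto intro!: sum.cong)
qed

text \<open>With K the identity, Tr A h(B) is a spectral double sum, and its nonnegative weights
  preserve a scalar inequality valid at all pairs of eigenvalues, whether or not A and B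
  commute.\<close>

lemma klein_upper:
  assumes "hermitian_mat n A" "hermitian_mat n B"
    and "\<And>i j. i < n \<Longrightarrow> j < n \<Longrightarrow>
      F (eig_vals A i) \<le> eig_vals A i * h (eig_vals B j) + k (eig_vals B j)"
  shows "rtr (mat_fun F A) \<le> rtr (A * mat_fun h B) + rtr (mat_fun k B)"
proof -
  have "bispec (\<lambda>x y. F x) A B (1\<^sub>m n) \<le> bispec (\<lambda>x y. x * h y + k y) A B (1\<^sub>m n)"
    by (rule bispec_mono[OF assms(1,2)]) (use assms(3) in auto)
  then show ?thesis
    using mat_fun_carrier[OF assms(1)] mat_fun_carrier[OF assms(2)] hermitian_carrier[OF assms(1)]
    by (simp add: bispec_add bispec_left[OF assms(1,2)] bispec_right[OF assms(1,2)]
        bispec_prod[OF assms(1,2)] mat_fun_ident[OF assms(1)] square_mat_simps[of _ n])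
qed

lemma klein_lower:
  assumes "hermitian_mat n A" "hermitian_mat n B"
    and "\<And>i j. i < n \<Longrightarrow> j < n \<Longrightarrow>
      eig_vals A i * h (eig_vals B j) + k (eig_vals B j) \<le> F (eig_vals A i)"
  shows "rtr (A * mat_fun h B) + rtr (mat_fun k B) \<le> rtr (mat_fun F A)"
proof -
  have "bispec (\<lambda>x y. x * h y + k y) A B (1\<^sub>m n) \<le> bispec (\<lambda>x y. F x) A B (1\<^sub>m n)"
    by (rule bispec_mono[OF assms(1,2)]) (use assms(3) in auto)
  then show ?thesis
    using mat_fun_carrier[OF assms(1)] mat_fun_carrier[OF assms(2)] hermitian_carrier[OF assms(1)]
    by (simp add: bispec_add bispec_left[OF assms(1,2)] bispec_right[OF assms(1,2)]
        bispec_prod[OF assms(1,2)] mat_fun_ident[OF assms(1)] square_mat_simps[of _ n])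
qed

lemma rtr_mat_fun:
  assumes "hermitian_mat n A"
  shows "rtr (mat_fun f A) = (\<Sum>i<n. f (eig_vals A i))"
proof -
  note d = eigen_decomp_eig[OF assms]
  have U: "eig_vecs A \<in> carrier_mat n n" "mat_adjoint (eig_vecs A) * eig_vecs A = 1\<^sub>m n"
    using d by (auto simp: eigen_decomp_def unitary_mat_def)
  show ?thesis
    unfolding mat_fun_eigen_decomp[OF d] rtr_def
    by (subst trace_cyclic[of _ n n])
      (use U in \<open>auto simp: assoc_mult_mat[symmetric, of _ n n _ n _ n] mult_carrier_mat[of _ n n _ n] mat_trace_def mat_diag_def\<close>)
qed

lemma klein_equality:
  assumes "hermitian_mat n A"
    and "\<And>i. i < n \<Longrightarrow> F (eig_vals A i) = eig_vals A i * h (eig_vals A i) + k (eig_vals A i)"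
  shows "rtr (mat_fun F A) = rtr (A * mat_fun h A) + rtr (mat_fun k A)"
proof -
  have "rtr (A * mat_fun h A) = rtr (mat_fun (\<lambda>x. x * h x) A)"
    using mat_fun_mult[OF assms(1), of "\<lambda>x. x" h] by (simp add: mat_fun_ident[OF assms(1)])
  then show ?thesis
    using assms(2) by (simp add: rtr_mat_fun[OF assms(1)] sum.distrib)
qed

text \<open>The equality case of Klein's inequality: the auxiliary matrix \<beta>(A) commutes with
  A, so all traces reduce to sums over the eigenvalues of A.\<close>

lemma klein_tight:
  assumes "hermitian_mat n A"
    and "\<And>i. i < n \<Longrightarrow> F (eig_vals A i) = eig_vals A i * h (\<beta> (eig_vals A i)) + k (\<beta> (eig_vals A i))"
  shows "rtr (mat_fun F A) = rtr (A * mat_fun h (mat_fun \<beta> A)) + rtr (mat_fun k (mat_fun \<beta> A))"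
  using klein_equality[of n A F "\<lambda>x. h (\<beta> x)" "\<lambda>x. k (\<beta> x)"] assms by (simp add: mat_fun_comp)

section \<open>Joint convexity\<close>

abbreviation mix :: "real \<Rightarrow> complex mat \<Rightarrow> complex mat \<Rightarrow> complex mat" where
  "mix t A B \<equiv> complex_of_real t \<cdot>\<^sub>m A + complex_of_real (1 - t) \<cdot>\<^sub>m B"

lemma rtr_mix:
  assumes "A \<in> carrier_mat n n" "B \<in> carrier_mat n n" "M \<in> carrier_mat n n"
  shows "rtr (mix t A B * M) = t * rtr (A * M) + (1 - t) * rtr (B * M)"
proof -
  have "mix t A B * M = complex_of_real t \<cdot>\<^sub>m (A * M) + complex_of_real (1 - t) \<cdot>\<^sub>m (B * M)"
    using assms by (simp add: add_mult_distrib_mat[of _ n n _ _ n] mult_smult_assoc_mat[of _ n n _ n])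
  then show ?thesis
    using assms
    by (simp add: rtr_add[of _ n] rtr_smult[of _ n] mult_carrier_mat[of _ n n _ n] del: of_real_diff)
qed

text \<open>Joint in (A, B) with K held fixed. Concavity is expressed through the negated kernel, so
  that the same closure properties serve both.\<close>

definition jconvex :: "nat \<Rightarrow> (real \<Rightarrow> real \<Rightarrow> real) \<Rightarrow> bool" where
  "jconvex n \<phi> \<longleftrightarrow> (\<forall>A1 A2 B1 B2 K t.
     pos_def_mat n A1 \<longrightarrow> pos_def_mat n A2 \<longrightarrow> pos_def_mat n B1 \<longrightarrow> pos_def_mat n B2 \<longrightarrow>
     K \<in> carrier_mat n n \<longrightarrow> 0 \<le> t \<longrightarrow> t \<le> 1 \<longrightarrow>
     bispec \<phi> (mix t A1 A2) (mix t B1 B2) K \<le> t * bispec \<phi> A1 B1 K + (1 - t) * bispec \<phi> A2 B2 K)"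

lemma jconvexI:
  assumes "\<And>A1 A2 B1 B2 K t. \<lbrakk>pos_def_mat n A1; pos_def_mat n A2; pos_def_mat n B1; pos_def_mat n B2;
      K \<in> carrier_mat n n; 0 \<le> t; t \<le> 1\<rbrakk> \<Longrightarrow>
     bispec \<phi> (mix t A1 A2) (mix t B1 B2) K \<le> t * bispec \<phi> A1 B1 K + (1 - t) * bispec \<phi> A2 B2 K"
  shows "jconvex n \<phi>"
  using assms unfolding jconvex_def by blast

lemma jconvexD:
  assumes "jconvex n \<phi>" "pos_def_mat n A1" "pos_def_mat n A2" "pos_def_mat n B1" "pos_def_mat n B2"
      "K \<in> carrier_mat n n" "0 \<le> t" "t \<le> 1"
  shows "bispec \<phi> (mix t A1 A2) (mix t B1 B2) K \<le> t * bispec \<phi> A1 B1 K + (1 - t) * bispec \<phi> A2 B2 K"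
  using assms unfolding jconvex_def by blast

section \<open>Closure properties of joint convexity\<close>

lemma pos_def_bispec_cong:
  assumes "pos_def_mat n A" "pos_def_mat n B"
    and "\<And>x y. x > 0 \<Longrightarrow> y > 0 \<Longrightarrow> \<phi> x y = \<psi> x y"
  shows "bispec \<phi> A B K = bispec \<psi> A B K"
  using assms(3) pos_defD(2)[OF assms(1)] pos_defD(2)[OF assms(2)]
  by (intro bispec_cong[OF pos_defD(1)[OF assms(1)] pos_defD(1)[OF assms(2)]]) auto

lemma jconvex_cong:
  assumes "jconvex n \<phi>" "\<And>x y. x > 0 \<Longrightarrow> y > 0 \<Longrightarrow> \<phi> x y = \<psi> x y"
  shows "jconvex n \<psi>"
proof (rule jconvexI)
  fix A1 A2 B1 B2 K :: "complex mat" and t :: real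
  assume a: "pos_def_mat n A1" "pos_def_mat n A2" "pos_def_mat n B1" "pos_def_mat n B2"
      "K \<in> carrier_mat n n" "0 \<le> t" "t \<le> 1"
  note eq = pos_def_bispec_cong[of n _ _ \<phi> \<psi>, OF _ _ assms(2)]
  show "bispec \<psi> (mix t A1 A2) (mix t B1 B2) K \<le> t * bispec \<psi> A1 B1 K + (1 - t) * bispec \<psi> A2 B2 K"
    using jconvexD[OF assms(1) a] eq[OF a(1,3)] eq[OF a(2,4)]
      eq[OF pos_def_comb[OF a(1,2,6,7)] pos_def_comb[OF a(3,4,6,7)]] by simp
qed

lemma jconvex_add:
  assumes "jconvex n \<phi>" "jconvex n \<psi>"
  shows "jconvex n (\<lambda>x y. \<phi> x y + \<psi> x y)"
proof (rule jconvexI)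
  fix A1 A2 B1 B2 K :: "complex mat" and t :: real
  assume a: "pos_def_mat n A1" "pos_def_mat n A2" "pos_def_mat n B1" "pos_def_mat n B2"
      "K \<in> carrier_mat n n" "0 \<le> t" "t \<le> 1"
  show "bispec (\<lambda>x y. \<phi> x y + \<psi> x y) (mix t A1 A2) (mix t B1 B2) K
      \<le> t * bispec (\<lambda>x y. \<phi> x y + \<psi> x y) A1 B1 K + (1 - t) * bispec (\<lambda>x y. \<phi> x y + \<psi> x y) A2 B2 K"
    using jconvexD[OF assms(1) a] jconvexD[OF assms(2) a] by (simp add: bispec_add distrib_left)
qed

lemma jconvex_cmult:
  assumes "jconvex n \<phi>" "c \<ge> 0"
  shows "jconvex n (\<lambda>x y. c * \<phi> x y)"
proof (rule jconvexI)
  fix A1 A2 B1 B2 K :: "complex mat" and t :: real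
  assume a: "pos_def_mat n A1" "pos_def_mat n A2" "pos_def_mat n B1" "pos_def_mat n B2"
      "K \<in> carrier_mat n n" "0 \<le> t" "t \<le> 1"
  show "bispec (\<lambda>x y. c * \<phi> x y) (mix t A1 A2) (mix t B1 B2) K
      \<le> t * bispec (\<lambda>x y. c * \<phi> x y) A1 B1 K + (1 - t) * bispec (\<lambda>x y. c * \<phi> x y) A2 B2 K"
    using mult_left_mono[OF jconvexD[OF assms(1) a] assms(2)] by (simp add: bispec_cmult algebra_simps)
qed

lemma jconvex_swap:
  assumes "jconvex n \<phi>"
  shows "jconvex n (\<lambda>x y. \<phi> y x)"
proof (rule jconvexI)
  fix A1 A2 B1 B2 K :: "complex mat" and t :: real
  assume a: "pos_def_mat n A1" "pos_def_mat n A2" "pos_def_mat n B1" "pos_def_mat n B2"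
      "K \<in> carrier_mat n n" "0 \<le> t" "t \<le> 1"
  note sw = bispec_swap[OF pos_defD(1) pos_defD(1) a(5)]
  show "bispec (\<lambda>x y. \<phi> y x) (mix t A1 A2) (mix t B1 B2) K
      \<le> t * bispec (\<lambda>x y. \<phi> y x) A1 B1 K + (1 - t) * bispec (\<lambda>x y. \<phi> y x) A2 B2 K"
    unfolding sw[OF a(1,3)] sw[OF a(2,4)] sw[OF pos_def_comb[OF a(1,2,6,7)] pos_def_comb[OF a(3,4,6,7)]]
    by (rule jconvexD[OF assms a(3,4,1,2) adjoint_carrier[OF a(5)] a(6,7)])
qed

lemma jconvex_linear: "jconvex n (\<lambda>x y. c * x)"
proof (rule jconvexI)
  fix A1 A2 B1 B2 K :: "complex mat" and t :: real
  assume a: "pos_def_mat n A1" "pos_def_mat n A2" "pos_def_mat n B1" "pos_def_mat n B2"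
      "K \<in> carrier_mat n n" "0 \<le> t" "t \<le> 1"
  have lin: "bispec (\<lambda>x y. c * x) A B K = c * rtr (A * (K * mat_adjoint K))"
    if "pos_def_mat n A" "pos_def_mat n B" for A B
    unfolding bispec_cmult
    using bispec_left[OF pos_defD(1)[OF that(1)] pos_defD(1)[OF that(2)] a(5), of "\<lambda>x. x"]
    by (simp add: mat_fun_ident[OF pos_defD(1)[OF that(1)]])
  have KK: "K * mat_adjoint K \<in> carrier_mat n n" using a(5) by (simp add: square_mat_simps[of _ n])
  show "bispec (\<lambda>x y. c * x) (mix t A1 A2) (mix t B1 B2) K
      \<le> t * bispec (\<lambda>x y. c * x) A1 B1 K + (1 - t) * bispec (\<lambda>x y. c * x) A2 B2 K"
    unfolding lin[OF a(1,3)] lin[OF a(2,4)] lin[OF pos_def_comb[OF a(1,2,6,7)] pos_def_comb[OF a(3,4,6,7)]]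
      rtr_mix[OF pos_defD(4)[OF a(1)] pos_defD(4)[OF a(2)] KK]
    by (simp add: algebra_simps)
qed

lemma jconvex_lim:
  fixes \<phi> :: "nat \<Rightarrow> real \<Rightarrow> real \<Rightarrow> real"
  assumes "\<And>k. jconvex n (\<phi> k)" "\<And>x y. x > 0 \<Longrightarrow> y > 0 \<Longrightarrow> (\<lambda>k. \<phi> k x y) \<longlonglongrightarrow> \<psi> x y"
  shows "jconvex n \<psi>"
proof (rule jconvexI)
  fix A1 A2 B1 B2 K :: "complex mat" and t :: real
  assume a: "pos_def_mat n A1" "pos_def_mat n A2" "pos_def_mat n B1" "pos_def_mat n B2"
      "K \<in> carrier_mat n n" "0 \<le> t" "t \<le> 1"
  have lim: "(\<lambda>k. bispec (\<phi> k) A B K) \<longlonglongrightarrow> bispec \<psi> A B K"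
    if "pos_def_mat n A" "pos_def_mat n B" for A B
    unfolding bispec_eq[OF pos_defD(1)[OF that(1)] pos_defD(1)[OF that(2)]]
    using that assms(2) pos_defD(2) by (intro tendsto_intros) auto
  show "bispec \<psi> (mix t A1 A2) (mix t B1 B2) K \<le> t * bispec \<psi> A1 B1 K + (1 - t) * bispec \<psi> A2 B2 K"
    using lim[OF a(1,3)] lim[OF a(2,4)] lim[OF pos_def_comb[OF a(1,2,6,7)] pos_def_comb[OF a(3,4,6,7)]]
      jconvexD[OF assms(1) a]
    by (intro LIMSEQ_le[where X = "\<lambda>k. bispec (\<phi> k) (mix t A1 A2) (mix t B1 B2) K"
          and Y = "\<lambda>k. t * bispec (\<phi> k) A1 B1 K + (1 - t) * bispec (\<phi> k) A2 B2 K"] tendsto_intros) auto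
qed

text \<open>Each double sum involves finitely many pairs of positive eigenvalues, so integrability
  at single points is enough to integrate the convexity inequality.\<close>

lemma jconvex_integral:
  fixes \<phi> :: "'a \<Rightarrow> real \<Rightarrow> real \<Rightarrow> real"
  assumes "\<And>l. jconvex n (\<phi> l)" "\<And>x y. x > 0 \<Longrightarrow> y > 0 \<Longrightarrow> integrable M (\<lambda>l. \<phi> l x y)"
  shows "jconvex n (\<lambda>x y. \<integral>l. \<phi> l x y \<partial>M)"
proof (rule jconvexI)
  fix A1 A2 B1 B2 K :: "complex mat" and t :: real
  assume a: "pos_def_mat n A1" "pos_def_mat n A2" "pos_def_mat n B1" "pos_def_mat n B2"
      "K \<in> carrier_mat n n" "0 \<le> t" "t \<le> 1"
  have int: "integrable M (\<lambda>l. bispec (\<phi> l) A B K)"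
    and eq: "bispec (\<lambda>x y. \<integral>l. \<phi> l x y \<partial>M) A B K = (\<integral>l. bispec (\<phi> l) A B K \<partial>M)"
    if "pos_def_mat n A" "pos_def_mat n B" for A B
  proof -
    have i: "integrable M (\<lambda>l. \<phi> l (eig_vals A i) (eig_vals B j))" if "i < n" "j < n" for i j
      using assms(2) pos_defD(2)[OF \<open>pos_def_mat n A\<close>] pos_defD(2)[OF \<open>pos_def_mat n B\<close>] that by auto
    show "integrable M (\<lambda>l. bispec (\<phi> l) A B K)"
      unfolding bispec_eq[OF pos_defD(1)[OF that(1)] pos_defD(1)[OF that(2)]]
      using i by (intro Bochner_Integration.integrable_sum integrable_mult_left) auto
    have "(\<integral>l. bispec (\<phi> l) A B K \<partial>M) = (\<Sum>i<n. \<integral>l. (\<Sum>j<n.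
        \<phi> l (eig_vals A i) (eig_vals B j) * (cmod (eig_overlap A B K $$ (i, j)))\<^sup>2) \<partial>M)"
      unfolding bispec_eq[OF pos_defD(1)[OF that(1)] pos_defD(1)[OF that(2)]]
      using i by (intro Bochner_Integration.integral_sum Bochner_Integration.integrable_sum integrable_mult_left) auto
    also have "\<dots> = (\<Sum>i<n. \<Sum>j<n. \<integral>l.
        \<phi> l (eig_vals A i) (eig_vals B j) * (cmod (eig_overlap A B K $$ (i, j)))\<^sup>2 \<partial>M)"
      using i by (intro sum.cong refl Bochner_Integration.integral_sum integrable_mult_left) auto
    finally show "bispec (\<lambda>x y. \<integral>l. \<phi> l x y \<partial>M) A B K = (\<integral>l. bispec (\<phi> l) A B K \<partial>M)"
      unfolding bispec_eq[OF pos_defD(1)[OF that(1)] pos_defD(1)[OF that(2)]] by simp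
  qed
  note mixpd = pos_def_comb[OF a(1,2,6,7)] pos_def_comb[OF a(3,4,6,7)]
  have "(\<integral>l. bispec (\<phi> l) (mix t A1 A2) (mix t B1 B2) K \<partial>M)
      \<le> (\<integral>l. t * bispec (\<phi> l) A1 B1 K + (1 - t) * bispec (\<phi> l) A2 B2 K \<partial>M)"
    using int[OF mixpd] int[OF a(1,3)] int[OF a(2,4)]
    by (intro integral_mono jconvexD[OF assms(1) a]) auto
  also have "\<dots> = t * (\<integral>l. bispec (\<phi> l) A1 B1 K \<partial>M) + (1 - t) * (\<integral>l. bispec (\<phi> l) A2 B2 K \<partial>M)"
    using int[OF a(1,3)] int[OF a(2,4)] by simp
  finally show "bispec (\<lambda>x y. \<integral>l. \<phi> l x y \<partial>M) (mix t A1 A2) (mix t B1 B2) K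
     \<le> t * bispec (\<lambda>x y. \<integral>l. \<phi> l x y \<partial>M) A1 B1 K + (1 - t) * bispec (\<lambda>x y. \<integral>l. \<phi> l x y \<partial>M) A2 B2 K"
    unfolding eq[OF a(1,3)] eq[OF a(2,4)] eq[OF mixpd] .
qed

text \<open>The quantity is the supremum over \<open>X\<close> of the affine functions
  \<open>2 Re Tr (A K X\<^sup>*) - \<mu> Tr (A X X\<^sup>*) - \<nu> Tr (B X\<^sup>* X)\<close> of the pair \<open>(A, B)\<close>; the proof inserts
  the maximizer belonging to the mixture.\<close>

lemma jconvex_quotient:
  assumes "\<mu> \<ge> 0" "\<nu> \<ge> 0" "\<mu> + \<nu> > 0"
  shows "jconvex n (\<lambda>x y. x\<^sup>2 / (\<mu> * x + \<nu> * y))"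
proof (rule jconvexI)
  fix A1 A2 B1 B2 K :: "complex mat" and t :: real
  assume a: "pos_def_mat n A1" "pos_def_mat n A2" "pos_def_mat n B1" "pos_def_mat n B2"
      "K \<in> carrier_mat n n" "0 \<le> t" "t \<le> 1"
  let ?J = "\<lambda>x y. x\<^sup>2 / (\<mu> * x + \<nu> * y)"
  have den: "\<mu> * x + \<nu> * y > 0" if "x > 0" "y > 0" for x y
    using assms that by (cases "\<mu> = 0") (auto intro: add_pos_nonneg)
  define A where "A = mix t A1 A2"
  define B where "B = mix t B1 B2"
  have pd: "pos_def_mat n A" "pos_def_mat n B"
    unfolding A_def B_def by (rule pos_def_comb[OF a(1,2,6,7)] pos_def_comb[OF a(3,4,6,7)])+
  note hA = pos_defD(1)[OF pd(1)] and hB = pos_defD(1)[OF pd(2)]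
  let ?U = "eig_vecs A" and ?V = "eig_vecs B"
  have U: "unitary_mat n ?U" and V: "unitary_mat n ?V"
    using eigen_decomp_eig[OF hA] eigen_decomp_eig[OF hB] by (auto simp: eigen_decomp_def)
  note Uc = unitary_matD[OF U] and Vc = unitary_matD[OF V]
  \<comment> \<open>In eigenbasis coordinates the functional splits into independent terms 2 a Re (k
    cnj x) - c |x|^2 with c = \<mu> a + \<nu> b, each maximal at x = a k / c.\<close>
  define Z where "Z = Matrix.mat n n (\<lambda>(i, j).
     complex_of_real (eig_vals A i / (\<mu> * eig_vals A i + \<nu> * eig_vals B j)) * eig_overlap A B K $$ (i, j))"
  define X where "X = ?U * Z * mat_adjoint ?V"
  have Z: "Z \<in> carrier_mat n n" by (simp add: Z_def)
  have X: "X \<in> carrier_mat n n" using Uc(1) Vc(1) Z by (simp add: X_def square_mat_simps[of _ n])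
  have XZ: "eig_overlap A B X = Z"
    using Uc Vc Z by (simp add: eig_overlap_def X_def square_mat_simps[of _ n] unitary_cancel[OF U])
  \<comment> \<open>X is now frozen, so \<open>L\<close> is linear in the pair, although the
    expansion below uses the eigenbases of whichever pair is inserted.\<close>
  define L where "L A B = 2 * rtr (A * (K * mat_adjoint X)) - \<mu> * rtr (A * (X * mat_adjoint X))
     - \<nu> * rtr (B * (mat_adjoint X * X))" for A B
  have L: "L A B = (\<Sum>i<n. \<Sum>j<n.
        2 * eig_vals A i * Re (eig_overlap A B K $$ (i, j) * cnj (eig_overlap A B X $$ (i, j)))
        - (\<mu> * eig_vals A i + \<nu> * eig_vals B j) * (cmod (eig_overlap A B X $$ (i, j)))\<^sup>2)"
    if "pos_def_mat n A" "pos_def_mat n B" for A B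
  proof -
    note h = pos_defD(1)[OF that(1)] pos_defD(1)[OF that(2)]
    have "rtr (A * (K * mat_adjoint X)) = rtr (mat_fun (\<lambda>x. x) A * K * mat_fun (\<lambda>x. 1) B * mat_adjoint X)"
      using hermitian_carrier[OF h(1)] a(5) X
      by (simp add: mat_fun_ident[OF h(1)] mat_fun_one[OF h(2)] square_mat_simps[of _ n])
    also have "\<dots> = (\<Sum>i<n. \<Sum>j<n. eig_vals A i *
        Re (eig_overlap A B K $$ (i, j) * cnj (eig_overlap A B X $$ (i, j))))"
      unfolding rtr_def trace_eig_overlap[OF h a(5) X] by simp
    finally have 1: "rtr (A * (K * mat_adjoint X)) = \<dots>" .
    have 2: "rtr (A * (X * mat_adjoint X)) = bispec (\<lambda>x y. x) A B X"
      unfolding bispec_left[OF h X] mat_fun_ident[OF h(1)] ..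
    have 3: "rtr (B * (mat_adjoint X * X)) = bispec (\<lambda>x y. y) A B X"
      unfolding bispec_right[OF h X] mat_fun_ident[OF h(2)] ..
    show ?thesis
      unfolding L_def 1 2 3 bispec_eq[OF h]
      by (simp only: sum_distrib_left flip: sum_subtractf) (intro sum.cong refl, simp add: algebra_simps)
  qed
  have upper: "L A B \<le> bispec ?J A B K" if "pos_def_mat n A" "pos_def_mat n B" for A B
    unfolding L[OF that] bispec_eq[OF pos_defD(1)[OF that(1)] pos_defD(1)[OF that(2)]]
  proof (intro sum_mono)
    fix i j assume "i \<in> {..<n}" "j \<in> {..<n}"
    then have pos: "eig_vals A i > 0" "eig_vals B j > 0"
      using pos_defD(2)[OF that(1)] pos_defD(2)[OF that(2)] by auto
    define c where "c = \<mu> * eig_vals A i + \<nu> * eig_vals B j"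
    have c: "c > 0" using den[OF pos] by (simp add: c_def)
    let ?a = "eig_vals A i" and ?k = "eig_overlap A B K $$ (i, j)" and ?x = "eig_overlap A B X $$ (i, j)"
    have "Re (?k * cnj ?x) \<le> cmod ?k * cmod ?x" using complex_Re_le_cmod[of "?k * cnj ?x"] by (simp add: norm_mult)
    then have "2 * ?a * Re (?k * cnj ?x) \<le> 2 * ?a * (cmod ?k * cmod ?x)" using pos by simp
    also have "\<dots> \<le> ?a\<^sup>2 / c * (cmod ?k)\<^sup>2 + c * (cmod ?x)\<^sup>2"
    proof -
      have "0 \<le> (?a * cmod ?k - c * cmod ?x)\<^sup>2 / c" using c by simp
      also have "\<dots> = ?a\<^sup>2 / c * (cmod ?k)\<^sup>2 + c * (cmod ?x)\<^sup>2 - 2 * ?a * (cmod ?k * cmod ?x)"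
        using c by (simp add: field_simps power2_eq_square)
      finally show ?thesis by simp
    qed
    finally show "2 * ?a * Re (?k * cnj ?x) - (\<mu> * ?a + \<nu> * eig_vals B j) * (cmod ?x)\<^sup>2
        \<le> ?a\<^sup>2 / (\<mu> * ?a + \<nu> * eig_vals B j) * (cmod ?k)\<^sup>2"
      by (simp add: c_def)
  qed
  have eq: "L A B = bispec ?J A B K"
    unfolding L[OF pd] bispec_eq[OF hA hB] XZ
  proof (intro sum.cong refl)
    fix i j assume ij: "i \<in> {..<n}" "j \<in> {..<n}"
    then have pos: "eig_vals A i > 0" "eig_vals B j > 0"
      using pos_defD(2)[OF pd(1)] pos_defD(2)[OF pd(2)] by auto
    define c where "c = \<mu> * eig_vals A i + \<nu> * eig_vals B j"
    have c: "c > 0" using den[OF pos] by (simp add: c_def)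
    let ?a = "eig_vals A i" and ?k = "eig_overlap A B K $$ (i, j)"
    have z: "Z $$ (i, j) = complex_of_real (?a / c) * ?k" using ij by (simp add: Z_def c_def)
    have "?k * cnj (Z $$ (i, j)) = complex_of_real (?a / c) * (?k * cnj ?k)" unfolding z by simp
    also have "\<dots> = complex_of_real (?a / c * (cmod ?k)\<^sup>2)"
      by (simp only: of_real_mult complex_norm_square)
    finally have re: "Re (?k * cnj (Z $$ (i, j))) = ?a / c * (cmod ?k)\<^sup>2" by (simp only: Re_complex_of_real)
    have norm: "(cmod (Z $$ (i, j)))\<^sup>2 = ?a\<^sup>2 / c\<^sup>2 * (cmod ?k)\<^sup>2"
      unfolding z by (simp add: norm_mult norm_divide power_mult_distrib power_divide)
    show "2 * ?a * Re (?k * cnj (Z $$ (i, j))) - (\<mu> * ?a + \<nu> * eig_vals B j) * (cmod (Z $$ (i, j)))\<^sup>2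
        = ?a\<^sup>2 / (\<mu> * ?a + \<nu> * eig_vals B j) * (cmod ?k)\<^sup>2"
      unfolding c_def[symmetric] re norm using c by (simp add: field_simps power2_eq_square)
  qed
  have aff: "L A B = t * L A1 B1 + (1 - t) * L A2 B2"
  proof -
    have c: "K * mat_adjoint X \<in> carrier_mat n n" "X * mat_adjoint X \<in> carrier_mat n n"
        "mat_adjoint X * X \<in> carrier_mat n n"
      using a(5) X by (simp_all add: square_mat_simps[of _ n])
    note m = rtr_mix[OF pos_defD(4) pos_defD(4)]
    show ?thesis
      unfolding L_def A_def B_def m[OF a(1,2) c(1)] m[OF a(1,2) c(2)] m[OF a(3,4) c(3)]
      by (simp add: algebra_simps)
  qed
  have "bispec ?J A B K = t * L A1 B1 + (1 - t) * L A2 B2" using eq aff by simp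
  also have "\<dots> \<le> t * bispec ?J A1 B1 K + (1 - t) * bispec ?J A2 B2 K"
    using upper[OF a(1,3)] upper[OF a(2,4)] a(6,7) by (intro add_mono mult_left_mono) auto
  finally show "bispec ?J (mix t A1 A2) (mix t B1 B2) K \<le> t * bispec ?J A1 B1 K + (1 - t) * bispec ?J A2 B2 K"
    by (simp only: A_def B_def)
qed

section \<open>Lieb concavity and Ando convexity\<close>

text \<open>Near 0 the kernel is dominated by l^(\<sigma> - 1), integrable since \<sigma> > 0; near
  infinity by l^(\<sigma> - 2), integrable since \<sigma> < 1.\<close>

lemma powr_integrable_kernel:
  fixes \<sigma> :: real
  assumes "0 < \<sigma>" "\<sigma> < 1"
  shows "integrable lborel (\<lambda>l. indicator {0<..} l * (l powr (\<sigma> - 1) / (1 + l)))"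
proof -
  have 1: "integrable lborel (\<lambda>l::real. indicator {0..1} l *\<^sub>R l powr (\<sigma> - 1))"
  proof -
    have "((\<lambda>l::real. l powr (\<sigma> - 1)) has_integral (1 / \<sigma>)) {0..1}"
      using has_integral_powr_from_0[of "\<sigma> - 1" 1] assms by simp
    then have "(\<lambda>l::real. l powr (\<sigma> - 1)) absolutely_integrable_on {0..1}"
      by (intro nonnegative_absolutely_integrable_1) (auto simp: has_integral_iff)
    then show ?thesis
      unfolding set_integrable_def by (subst (asm) integrable_completion) auto
  qed
  have 2: "integrable lborel (\<lambda>l::real. indicator {1..} l *\<^sub>R l powr (\<sigma> - 2))"
  proof -
    have "((\<lambda>l::real. l powr (\<sigma> - 2)) has_integral (- (1 powr (\<sigma> - 2 + 1)) / (\<sigma> - 2 + 1))) {1..}"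
      using assms by (intro has_integral_powr_to_inf) auto
    then have "(\<lambda>l::real. l powr (\<sigma> - 2)) absolutely_integrable_on {1..}"
      by (intro nonnegative_absolutely_integrable_1) (auto simp: has_integral_iff)
    then show ?thesis
      unfolding set_integrable_def by (subst (asm) integrable_completion) auto
  qed
  show ?thesis
  proof (rule Bochner_Integration.integrable_bound[OF Bochner_Integration.integrable_add[OF 1 2]])
    show "AE l in lborel. norm (indicator {0<..} l * (l powr (\<sigma> - 1) / (1 + l)))
        \<le> norm (indicator {0..1} l *\<^sub>R l powr (\<sigma> - 1) + indicator {1..} l *\<^sub>R l powr (\<sigma> - 2))"
    proof (rule AE_I2)
      fix l :: real
      consider "l \<le> 0" | "0 < l" "l \<le> 1" | "1 < l" by linarith
      then show "norm (indicator {0<..} l * (l powr (\<sigma> - 1) / (1 + l)))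
        \<le> norm (indicator {0..1} l *\<^sub>R l powr (\<sigma> - 1) + indicator {1..} l *\<^sub>R l powr (\<sigma> - 2))"
      proof cases
        case 1
        then show ?thesis by simp
      next
        case 2
        then have "l powr (\<sigma> - 1) / (1 + l) \<le> l powr (\<sigma> - 1) / 1" by (intro divide_left_mono) auto
        then show ?thesis using 2 by (auto simp: indicator_def)
      next
        case 3
        have "l powr (\<sigma> - 1) / (1 + l) \<le> l powr (\<sigma> - 1) / l" using 3 by (intro divide_left_mono) auto
        also have "\<dots> = l powr (\<sigma> - 2)" using 3 powr_diff[of l "\<sigma> - 1" 1] by simp
        finally show ?thesis using 3 by (auto simp: indicator_def)
      qed
    qed
  qed measurable
qed

text \<open>The substitution of x l for l pulls out x^\<sigma> and leaves a constant. Its value is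
  pi / sin (pi \<sigma>), but only its positivity matters, since it will be divided out.\<close>

lemma powr_integral_representation:
  fixes \<sigma> :: real
  assumes "0 < \<sigma>" "\<sigma> < 1"
  obtains c :: real where "c > 0"
    "\<And>x. x > 0 \<Longrightarrow> integrable lborel (\<lambda>l. indicator {0<..} l * (l powr (\<sigma> - 1) * (x / (x + l))))"
    "\<And>x. x > 0 \<Longrightarrow> (\<integral>l. indicator {0<..} l * (l powr (\<sigma> - 1) * (x / (x + l))) \<partial>lborel) = c * x powr \<sigma>"
proof
  let ?g = "\<lambda>l::real. indicator {0<..} l * (l powr (\<sigma> - 1) / (1 + l))"
  define c where "c = (\<integral>l. ?g l \<partial>lborel)"
  note int = powr_integrable_kernel[OF assms]
  \<comment> \<open>The terms \<open>0 +\<close> match the affine form of the Lebesgue substitution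
    rule.\<close>
  have scale: "indicator {0<..} (0 + x * l) * ((0 + x * l) powr (\<sigma> - 1) * (x / (x + (0 + x * l)))) = x powr (\<sigma> - 1) * ?g l"
    if "x > 0" for x l :: real
  proof (cases "l > 0")
    case True
    have "x + x * l = x * (1 + l)" by (simp add: algebra_simps)
    then have "x / (x + x * l) = 1 / (1 + l)" using that by simp
    then show ?thesis using True that by (simp add: powr_mult)
  next
    case False
    then have "\<not> x * l > 0" using that by (simp add: zero_less_mult_iff)
    then show ?thesis using False by simp
  qed
  show "integrable lborel (\<lambda>l. indicator {0<..} l * (l powr (\<sigma> - 1) * (x / (x + l))))" if "x > 0" for x :: real
  proof -
    let ?f = "\<lambda>l. indicator {0<..} l * (l powr (\<sigma> - 1) * (x / (x + l)))"
    have "integrable lborel (\<lambda>l. ?f (0 + x * l))"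
      unfolding scale[OF that] by (rule integrable_mult_right[OF int])
    then show ?thesis using lborel_integrable_real_affine_iff[of x ?f 0] that by blast
  qed
  show "(\<integral>l. indicator {0<..} l * (l powr (\<sigma> - 1) * (x / (x + l))) \<partial>lborel) = c * x powr \<sigma>"
    if "x > 0" for x :: real
  proof -
    have "(\<integral>l. indicator {0<..} l * (l powr (\<sigma> - 1) * (x / (x + l))) \<partial>lborel) = x * (x powr (\<sigma> - 1) * c)"
      using that
      by (subst lborel_integral_real_affine[of x _ 0])
        (simp_all only: scale integral_mult_right_zero c_def, simp_all)
    also have "x * (x powr (\<sigma> - 1) * c) = c * x powr \<sigma>"
      using that powr_diff[of x \<sigma> 1] by simp
    finally show ?thesis .
  qed
  \<comment> \<open>On [1, 2] the power is at least 1/2 and 1 + l is at most 3, whence 1/6.\<close>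
  have low: "indicator {1..2} l *\<^sub>R (1 / 6) \<le> ?g l" for l :: real
  proof (cases "l \<in> {1..2}")
    case True
    have "1 / 2 \<le> l powr (-1)" using True by (simp add: powr_minus divide_simps)
    also have "\<dots> \<le> l powr (\<sigma> - 1)" using True assms by (intro powr_mono) auto
    finally have "1 / 2 / 3 \<le> l powr (\<sigma> - 1) / (1 + l)" using True by (intro frac_le) auto
    then show ?thesis using True by simp
  qed (auto simp: indicator_def)
  have "(\<integral>l. indicator {1..2::real} l *\<^sub>R (1 / 6 :: real) \<partial>lborel) \<le> c"
    unfolding c_def by (intro integral_mono low int integrable_scaleR_left integrable_real_indicator) auto
  then show "c > 0" by simp
qed

lemma jconvex_zero: "jconvex n (\<lambda>x y. 0)"
  using jconvex_linear[of n 0] by simp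

text \<open>Write the kernel as x (x/y)^\<sigma> and insert the integral at x/y: the integrand
  becomes x^2 / (x + l y) times a nonnegative factor.\<close>

lemma jconvex_powr_gt1:
  assumes "0 < \<sigma>" "\<sigma> < 1"
  shows "jconvex n (\<lambda>x y. x powr (1 + \<sigma>) * y powr (- \<sigma>))"
proof -
  obtain c :: real where c: "c > 0"
    and int: "\<And>x. x > 0 \<Longrightarrow> integrable lborel (\<lambda>l. indicator {0<..} l * (l powr (\<sigma> - 1) * (x / (x + l))))"
    and eq: "\<And>x. x > 0 \<Longrightarrow> (\<integral>l. indicator {0<..} l * (l powr (\<sigma> - 1) * (x / (x + l))) \<partial>lborel) = c * x powr \<sigma>"
    using powr_integral_representation[OF assms] by blast
  define f where "f l x y = (if l > 0 then l powr (\<sigma> - 1) * (x\<^sup>2 / (1 * x + l * y)) else 0)" for l x y :: real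
  have f_eq: "f l x y = x * (indicator {0<..} l * (l powr (\<sigma> - 1) * ((x / y) / (x / y + l))))"
    if "x > 0" "y > 0" for l x y
    using that by (auto simp: f_def field_simps power2_eq_square)
  have "jconvex n (f l)" for l
    unfolding f_def[abs_def] using jconvex_cmult[OF jconvex_quotient[of 1 l n]]
    by (cases "l > 0") (auto simp: jconvex_zero)
  then have "jconvex n (\<lambda>x y. \<integral>l. f l x y \<partial>lborel)"
    by (rule jconvex_integral) (simp only: f_eq, intro integrable_mult_right int, simp)
  then have "jconvex n (\<lambda>x y. 1 / c * (\<integral>l. f l x y \<partial>lborel))"
    using c by (intro jconvex_cmult) auto
  then show ?thesis
  proof (rule jconvex_cong)
    fix x y :: real assume xy: "x > 0" "y > 0"
    have "(\<integral>l. f l x y \<partial>lborel) = x * (c * (x / y) powr \<sigma>)"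
      using xy by (simp only: f_eq integral_mult_right_zero eq[of "x / y"] divide_pos_pos)
    then show "1 / c * (\<integral>l. f l x y \<partial>lborel) = x powr (1 + \<sigma>) * y powr (- \<sigma>)"
      using c xy by (simp add: powr_add powr_divide powr_minus field_simps)
  qed
qed

text \<open>Now -y (x/y)^\<sigma> is represented, with integrand a multiple of -x y / (x + l y). The
  identity -l x y / (x + l y) = x^2 / (x + l y) - x turns it into a quotient kernel plus a linear
  one, at the price of a factor 1/l.\<close>

lemma jconvex_powr_lt1:
  assumes "0 < \<sigma>" "\<sigma> < 1"
  shows "jconvex n (\<lambda>x y. - (x powr \<sigma> * y powr (1 - \<sigma>)))"
proof -
  obtain c :: real where c: "c > 0"
    and int: "\<And>x. x > 0 \<Longrightarrow> integrable lborel (\<lambda>l. indicator {0<..} l * (l powr (\<sigma> - 1) * (x / (x + l))))"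
    and eq: "\<And>x. x > 0 \<Longrightarrow> (\<integral>l. indicator {0<..} l * (l powr (\<sigma> - 1) * (x / (x + l))) \<partial>lborel) = c * x powr \<sigma>"
    using powr_integral_representation[OF assms] by blast
  define f where "f l x y = (if l > 0 then l powr (\<sigma> - 1) / l * (x\<^sup>2 / (1 * x + l * y) + (-1) * x) else 0)" for l x y :: real
  have f_eq: "f l x y = - y * (indicator {0<..} l * (l powr (\<sigma> - 1) * ((x / y) / (x / y + l))))"
    if "x > 0" "y > 0" for l x y
  proof (cases "l > 0")
    case True
    have "x + l * y \<noteq> 0" using True that by (smt (verit) mult_pos_pos)
    then have "x\<^sup>2 / (x + l * y) - x = - l * (x * y / (x + l * y))"
      by (simp add: field_simps power2_eq_square)
    then have "f l x y = l powr (\<sigma> - 1) / l * (- l * (x * y / (x + l * y)))" using True by (simp add: f_def)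
    also have "\<dots> = - y * (l powr (\<sigma> - 1) * (x / (x + l * y)))" using True by simp
    also have "x / (x + l * y) = (x / y) / (x / y + l)" using that by (simp add: field_simps)
    finally show ?thesis using True by simp
  qed (simp add: f_def)
  have "jconvex n (f l)" for l
    unfolding f_def[abs_def] using jconvex_cmult[OF jconvex_add[OF jconvex_quotient[of 1 l n] jconvex_linear[of n "-1"]],
          of "l powr (\<sigma> - 1) / l"]
    by (cases "l > 0") (auto simp: jconvex_zero)
  then have "jconvex n (\<lambda>x y. \<integral>l. f l x y \<partial>lborel)"
    by (rule jconvex_integral) (simp only: f_eq, intro integrable_mult_right int, simp)
  then have "jconvex n (\<lambda>x y. 1 / c * (\<integral>l. f l x y \<partial>lborel))"
    using c by (intro jconvex_cmult) auto
  then show ?thesis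
  proof (rule jconvex_cong)
    fix x y :: real assume xy: "x > 0" "y > 0"
    have "(\<integral>l. f l x y \<partial>lborel) = - y * (c * (x / y) powr \<sigma>)"
      using xy by (simp only: f_eq integral_mult_right_zero eq[of "x / y"] divide_pos_pos)
    then show "1 / c * (\<integral>l. f l x y \<partial>lborel) = - (x powr \<sigma> * y powr (1 - \<sigma>))"
      using c xy by (simp add: powr_diff powr_divide field_simps)
  qed
qed

theorem lieb_concavity:
  assumes "0 \<le> s" "s \<le> 1"
  shows "jconvex n (\<lambda>x y. - (x powr s * y powr (1 - s)))"
proof -
  consider "s = 0" | "s = 1" | "0 < s" "s < 1" using assms by linarith
  then show ?thesis
  proof cases
    case 1
    show ?thesis by (rule jconvex_cong[OF jconvex_swap[OF jconvex_linear[of n "-1"]]]) (simp add: 1)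
  next
    case 2
    show ?thesis by (rule jconvex_cong[OF jconvex_linear[of n "-1"]]) (simp add: 2)
  qed (rule jconvex_powr_lt1)
qed

theorem ando_convexity:
  assumes "1 \<le> s" "s \<le> 2"
  shows "jconvex n (\<lambda>x y. x powr s * y powr (1 - s))"
proof -
  consider "s = 1" | "s = 2" | "1 < s" "s < 2" using assms by linarith
  then show ?thesis
  proof cases
    case 1
    show ?thesis by (rule jconvex_cong[OF jconvex_linear[of n 1]]) (simp add: 1)
  next
    case 2
    \<comment> \<open>The endpoint x^2 / y is itself a quotient kernel, with \<mu> = 0 and \<nu> =
      1.\<close>
    show ?thesis by (rule jconvex_cong[OF jconvex_quotient[of 0 1]]) (simp_all add: 2 powr_minus divide_inverse)
  next
    case 3
    then show ?thesis using jconvex_powr_gt1[of "s - 1" n] by simp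
  qed
qed

text \<open>Exchanging the variables exchanges the exponents s and 1 - s, which maps [-1, 0] onto
  [1, 2].\<close>

theorem ando_convexity_neg:
  assumes "-1 \<le> s" "s \<le> 0"
  shows "jconvex n (\<lambda>x y. x powr s * y powr (1 - s))"
  using jconvex_swap[OF ando_convexity[of "1 - s" n]] assms by (simp add: mult.commute)

text \<open>The kernel is minus the derivative of x^s y^(1-s) at s = 0, hence the limit of (y - x^s
  y^(1-s)) / s as s decreases to 0; each of these is jointly convex by Lieb concavity and linearity
  in y.\<close>

theorem relative_entropy_convexity: "jconvex n (\<lambda>x y. y * ln y - y * ln x)"
proof (rule jconvex_lim)
  define s where "s k = inverse (real (Suc k))" for k
  have s: "0 < s k" "s k \<le> 1" for k by (auto simp: s_def inverse_le_1_iff)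
  show "jconvex n (\<lambda>x y. inverse (s k) * (- (x powr s k * y powr (1 - s k)) + y))" for k
    using s[of k] jconvex_swap[OF jconvex_linear[of n 1]]
    by (intro jconvex_cmult jconvex_add lieb_concavity) auto
  fix x y :: real assume xy: "x > 0" "y > 0"
  have "((\<lambda>h. (x / y) powr h) has_real_derivative ln (x / y)) (at 0)"
    using xy by (auto intro!: derivative_eq_intros)
  then have "((\<lambda>h. ((x / y) powr h - 1) / h) \<longlongrightarrow> ln (x / y)) (at 0)"
    using xy by (simp add: has_field_derivative_iff)
  moreover have "filterlim s (at 0) sequentially"
    unfolding filterlim_at s_def using LIMSEQ_inverse_real_of_nat by auto
  ultimately have "(\<lambda>k. ((x / y) powr s k - 1) / s k) \<longlonglongrightarrow> ln (x / y)"
    by (rule filterlim_compose)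
  then have "(\<lambda>k. - y * (((x / y) powr s k - 1) / s k)) \<longlonglongrightarrow> - y * ln (x / y)"
    by (intro tendsto_intros)
  moreover have "- y * (((x / y) powr s k - 1) / s k) = inverse (s k) * (- (x powr s k * y powr (1 - s k)) + y)" for k
    using xy s[of k] by (simp add: powr_divide powr_diff field_simps)
  moreover have "- y * ln (x / y) = y * ln y - y * ln x" using xy by (simp add: ln_div algebra_simps)
  ultimately show "(\<lambda>k. inverse (s k) * (- (x powr s k * y powr (1 - s k)) + y)) \<longlonglongrightarrow> y * ln y - y * ln x"
    by simp
qed

section \<open>Trace functions of compressed matrices\<close>

text \<open>Operator convexity of f tested against positive semidefinite weights instead of being
  stated in the Loewner order: the functionals below see f(A) only through such traces.\<close>

definition opconvex :: "nat \<Rightarrow> (real \<Rightarrow> real) \<Rightarrow> bool" where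
  "opconvex n f \<longleftrightarrow> (\<forall>A1 A2 W t.
     pos_def_mat n A1 \<longrightarrow> pos_def_mat n A2 \<longrightarrow> pos_semidef_mat n W \<longrightarrow> 0 \<le> t \<longrightarrow> t \<le> 1 \<longrightarrow>
     rtr (mat_fun f (mix t A1 A2) * W) \<le> t * rtr (mat_fun f A1 * W) + (1 - t) * rtr (mat_fun f A2 * W))"

lemma opconvexD:
  assumes "opconvex n f" "pos_def_mat n A1" "pos_def_mat n A2" "pos_semidef_mat n W" "0 \<le> t" "t \<le> 1"
  shows "rtr (mat_fun f (mix t A1 A2) * W) \<le> t * rtr (mat_fun f A1 * W) + (1 - t) * rtr (mat_fun f A2 * W)"
  using assms unfolding opconvex_def by blast

lemma mix_same: "A \<in> carrier_mat n n \<Longrightarrow> mix t A A = A"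
  by (intro eq_matI) (auto simp: algebra_simps)

text \<open>Freeze B at the identity and write W = K K^*; mixing the identity with itself changes
  nothing, so the second variable disappears.\<close>

lemma jconvex_imp_opconvex_fst:
  assumes "jconvex n \<phi>" "\<And>x. x > 0 \<Longrightarrow> f x = \<phi> x 1"
  shows "opconvex n f"
  unfolding opconvex_def
proof (intro allI impI)
  fix A1 A2 W :: "complex mat" and t :: real
  assume a: "pos_def_mat n A1" "pos_def_mat n A2" "pos_semidef_mat n W" "0 \<le> t" "t \<le> 1"
  obtain K where K: "K \<in> carrier_mat n n" "W = K * mat_adjoint K"
    using pos_semidef_sqrt[OF a(3)] by blast
  have "bispec \<phi> A (1\<^sub>m n) K = rtr (mat_fun f A * W)" if "pos_def_mat n A" for A
  proof -
    have "bispec \<phi> A (1\<^sub>m n) K = bispec (\<lambda>x y. f x) A (1\<^sub>m n) K"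
      using assms(2) pos_defD(2)[OF that] eig_vals_one
      by (intro bispec_cong[OF pos_defD(1)[OF that] hermitian_one]) auto
    then show ?thesis unfolding bispec_left[OF pos_defD(1)[OF that] hermitian_one K(1)] K(2) .
  qed
  then show "rtr (mat_fun f (mix t A1 A2) * W) \<le> t * rtr (mat_fun f A1 * W) + (1 - t) * rtr (mat_fun f A2 * W)"
    using jconvexD[OF assms(1) a(1,2) pos_def_one pos_def_one K(1) a(4,5)] a
      pos_def_comb[OF a(1,2,4,5)]
    by (simp add: mix_same[of _ n] del: of_real_diff)
qed

lemma jconvex_imp_opconvex_snd:
  assumes "jconvex n \<phi>" "\<And>y. y > 0 \<Longrightarrow> f y = \<phi> 1 y"
  shows "opconvex n f"
  using jconvex_imp_opconvex_fst[OF jconvex_swap[OF assms(1)]] assms(2) by blast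

section \<open>Linear combinations in the functional calculus, and congruences\<close>

lemma mat_fun_linear:
  assumes "hermitian_mat n A"
  shows "mat_fun (\<lambda>x. c * f x + d * g x) A
    = complex_of_real c \<cdot>\<^sub>m mat_fun f A + complex_of_real d \<cdot>\<^sub>m mat_fun g A"
proof -
  note U = eig_vecs_carrier[OF assms]
  note e = mat_fun_eigen_decomp[OF eigen_decomp_eig[OF assms]]
  show ?thesis
  proof (rule eq_matI)
    fix i j
    assume "i < dim_row (complex_of_real c \<cdot>\<^sub>m mat_fun f A + complex_of_real d \<cdot>\<^sub>m mat_fun g A)"
      "j < dim_col (complex_of_real c \<cdot>\<^sub>m mat_fun f A + complex_of_real d \<cdot>\<^sub>m mat_fun g A)"
    then have ij: "i < n" "j < n" using mat_fun_carrier[OF assms, of g] by auto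
    have m: "mat_fun h A $$ (i, j) = (\<Sum>k<n. eig_vecs A $$ (i, k) * complex_of_real (h (eig_vals A k)) * cnj (eig_vecs A $$ (j, k)))" for h
      unfolding e by (rule conj_diag_index[OF U ij])
    have "(complex_of_real c \<cdot>\<^sub>m mat_fun f A + complex_of_real d \<cdot>\<^sub>m mat_fun g A) $$ (i, j)
        = complex_of_real c * mat_fun f A $$ (i, j) + complex_of_real d * mat_fun g A $$ (i, j)"
      using ij mat_fun_carrier[OF assms, of f] mat_fun_carrier[OF assms, of g] by simp
    then show "mat_fun (\<lambda>x. c * f x + d * g x) A $$ (i, j)
        = (complex_of_real c \<cdot>\<^sub>m mat_fun f A + complex_of_real d \<cdot>\<^sub>m mat_fun g A) $$ (i, j)"
      unfolding m by (simp add: sum_distrib_left sum.distrib algebra_simps)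
  qed (use mat_fun_carrier[OF assms, of f] mat_fun_carrier[OF assms, of g]
        mat_fun_carrier[OF assms, of "\<lambda>x. c * f x + d * g x"] in auto)
qed

lemma mat_fun_cmult:
  assumes "hermitian_mat n A"
  shows "mat_fun (\<lambda>x. c * f x) A = complex_of_real c \<cdot>\<^sub>m mat_fun f A"
proof -
  have "mat_fun (\<lambda>x. c * f x) A = complex_of_real c \<cdot>\<^sub>m mat_fun f A + complex_of_real 0 \<cdot>\<^sub>m mat_fun f A"
    using mat_fun_linear[OF assms, of c f 0 f] by simp
  also have "\<dots> = complex_of_real c \<cdot>\<^sub>m mat_fun f A" by (intro eq_matI) auto
  finally show ?thesis .
qed

lemma pos_semidef_congruence:
  assumes H: "H \<in> carrier_mat n n" and W: "pos_semidef_mat n W"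
  shows "pos_semidef_mat n (H * W * mat_adjoint H)"
proof -
  have c: "W \<in> carrier_mat n n" "mat_adjoint W = W"
    using W by (auto simp: pos_semidef_mat_def hermitian_mat_def)
  then have "hermitian_mat n (H * W * mat_adjoint H)"
    using H by (simp add: hermitian_mat_def square_mat_simps[of _ n])
  moreover have "Re (qform (H * W * mat_adjoint H) v) \<ge> 0" if "v \<in> carrier_vec n" for v
    using qform_congruence[OF adjoint_carrier[OF H] c(1) that] W
      mult_mat_vec_carrier[OF adjoint_carrier[OF H] that]
    by (simp add: pos_semidef_mat_def)
  ultimately show ?thesis by (simp add: pos_semidef_mat_def)
qed

lemma hermitian_add: "hermitian_mat n A \<Longrightarrow> hermitian_mat n B \<Longrightarrow> hermitian_mat n (A + B)"
  by (auto simp: hermitian_mat_def adjoint_add[of _ n n])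

lemma hermitian_congruence:
  "H \<in> carrier_mat n n \<Longrightarrow> hermitian_mat n W \<Longrightarrow> hermitian_mat n (mat_adjoint H * W * H)"
  by (simp add: hermitian_mat_def square_mat_simps[of _ n])

text \<open>Covers both Y(A) for p different from 1 and the exponent L + H^* log(A) H for p =
  1.\<close>

definition sandwich :: "complex mat \<Rightarrow> complex mat \<Rightarrow> (real \<Rightarrow> real) \<Rightarrow> complex mat \<Rightarrow> complex mat" where
  "sandwich C H f A = C + mat_adjoint H * mat_fun f A * H"

lemma hermitian_sandwich:
  "hermitian_mat n C \<Longrightarrow> H \<in> carrier_mat n n \<Longrightarrow> hermitian_mat n A \<Longrightarrow> hermitian_mat n (sandwich C H f A)"
  unfolding sandwich_def by (intro hermitian_add hermitian_congruence hermitian_mat_fun)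

text \<open>By cyclicity the compression acts on the weight instead: f(A) is paired with H W H^*,
  which is positive semidefinite whenever W is.\<close>

lemma rtr_sandwich:
  assumes "C \<in> carrier_mat n n" "H \<in> carrier_mat n n" "hermitian_mat n A" "W \<in> carrier_mat n n"
  shows "rtr (sandwich C H f A * W) = rtr (C * W) + rtr (mat_fun f A * (H * W * mat_adjoint H))"
proof -
  note f = mat_fun_carrier[OF assms(3), of f]
  have "rtr (sandwich C H f A * W) = rtr (C * W) + rtr (mat_adjoint H * (mat_fun f A * H * W))"
    using assms f
    by (simp add: sandwich_def add_mult_distrib_mat[of _ n n _ _ n] rtr_add[of _ n] square_mat_simps[of _ n])
  also have "rtr (mat_adjoint H * (mat_fun f A * H * W)) = rtr (mat_fun f A * (H * W * mat_adjoint H))"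
    using assms f by (subst rtr_cyclic[of _ n n]) (auto simp: square_mat_simps[of _ n])
  finally show ?thesis .
qed

section \<open>Convexity on positive definite matrices and envelope arguments\<close>

lemma convex_on_pd_cong:
  assumes "convex_on_pd n f" "\<And>A. pos_def_mat n A \<Longrightarrow> f A = g A"
  shows "convex_on_pd n g"
  using assms pos_def_comb unfolding convex_on_pd_def by metis

lemma concave_on_pd_cong:
  assumes "concave_on_pd n f" "\<And>A. pos_def_mat n A \<Longrightarrow> f A = g A"
  shows "concave_on_pd n g"
  using assms pos_def_comb unfolding concave_on_pd_def by metis

lemma concave_on_pd_uminus:
  assumes "convex_on_pd n f" "\<And>A. pos_def_mat n A \<Longrightarrow> f A = - g A"
  shows "concave_on_pd n g"
  unfolding concave_on_pd_def
proof (intro allI impI)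
  fix A B :: "complex mat" and t :: real
  assume a: "pos_def_mat n A" "pos_def_mat n B" "0 \<le> t" "t \<le> 1"
  then have "f (mix t A B) \<le> t * f A + (1 - t) * f B" using assms(1) unfolding convex_on_pd_def by blast
  then show "t * g A + (1 - t) * g B \<le> g (mix t A B)"
    using assms(2)[OF a(1)] assms(2)[OF a(2)] assms(2)[OF pos_def_comb[OF a]]
    by simp
qed

text \<open>If \<open>F\<close> is the upper envelope of the functions \<open>x \<mapsto> c x w(z) + k(z)\<close>, then it suffices to test
  against the weight \<open>w\<close> evaluated at the mixture.\<close>

theorem trace_sandwich_convex_upper:
  assumes op: "opconvex n (\<lambda>x. c * f x)" and C: "hermitian_mat n C" and H: "H \<in> carrier_mat n n"
    and I: "\<And>A i. pos_def_mat n A \<Longrightarrow> i < n \<Longrightarrow> eig_vals (sandwich C H f A) i \<in> I"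
    and w: "\<And>x. x \<in> I \<Longrightarrow> w x > 0"
    and le: "\<And>x z. x \<in> I \<Longrightarrow> z \<in> I \<Longrightarrow> x * (c * w z) + k z \<le> F x"
    and eq: "\<And>x. x \<in> I \<Longrightarrow> F x = x * (c * w x) + k x"
  shows "convex_on_pd n (\<lambda>A. rtr (mat_fun F (sandwich C H f A)))"
  unfolding convex_on_pd_def
proof (intro allI impI)
  fix A1 A2 :: "complex mat" and t :: real
  assume a: "pos_def_mat n A1" "pos_def_mat n A2" "0 \<le> t" "t \<le> 1"
  define A where "A = mix t A1 A2"
  have A: "pos_def_mat n A" unfolding A_def by (rule pos_def_comb[OF a])
  let ?X = "sandwich C H f"
  have hX: "hermitian_mat n (?X A)" if "pos_def_mat n A" for A
    using hermitian_sandwich[OF C H pos_defD(1)[OF that]] .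
  let ?h = "mat_fun (\<lambda>x. c * w x) (?X A)" and ?k = "rtr (mat_fun k (?X A))"
  have W: "pos_semidef_mat n (mat_fun w (?X A))"
    using I[OF A] w by (intro pos_defD(3) pos_def_mat_fun[OF hX[OF A]]) auto
  then have Wc: "mat_fun w (?X A) \<in> carrier_mat n n" using mat_fun_carrier[OF hX[OF A]] by simp
  let ?M = "H * mat_fun w (?X A) * mat_adjoint H"
  have M: "?M \<in> carrier_mat n n" using H Wc by (simp add: square_mat_simps[of _ n])
  \<comment> \<open>The scalar \<open>c\<close> is moved from the weight onto f because it is the
    product c f that is assumed convex; \<open>c\<close> may be negative.\<close>
  have test: "rtr (?X A' * ?h) = c * rtr (C * mat_fun w (?X A)) + rtr (mat_fun (\<lambda>x. c * f x) A' * ?M)"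
    if "pos_def_mat n A'" for A'
  proof -
    note h = hermitian_carrier[OF hX[OF that]] mat_fun_carrier[OF pos_defD(1)[OF that], of f]
    have "rtr (?X A' * ?h) = c * rtr (?X A' * mat_fun w (?X A))"
      using h Wc unfolding mat_fun_cmult[OF hX[OF A]]
      by (simp add: mult_smult_distrib[of _ n n _ n] rtr_smult[of _ n] square_mat_simps[of _ n])
    also have "\<dots> = c * rtr (C * mat_fun w (?X A)) + c * rtr (mat_fun f A' * ?M)"
      using rtr_sandwich[OF hermitian_carrier[OF C] H pos_defD(1)[OF that] Wc]
      by (simp add: distrib_left)
    also have "c * rtr (mat_fun f A' * ?M) = rtr (mat_fun (\<lambda>x. c * f x) A' * ?M)"
      using h M unfolding mat_fun_cmult[OF pos_defD(1)[OF that]]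
      by (simp add: mult_smult_assoc_mat[of _ n n _ n] rtr_smult[of _ n] mult_carrier_mat[of _ n n _ n])
    finally show ?thesis .
  qed
  have low: "rtr (?X A' * ?h) + ?k \<le> rtr (mat_fun F (?X A'))" if "pos_def_mat n A'" for A'
    using I[OF that] I[OF A] le by (intro klein_lower[OF hX[OF that] hX[OF A]]) auto
  have "rtr (mat_fun F (?X A)) = rtr (?X A * ?h) + ?k"
    using I[OF A] eq by (intro klein_equality[OF hX[OF A]]) auto
  also have "rtr (?X A * ?h) \<le> t * rtr (?X A1 * ?h) + (1 - t) * rtr (?X A2 * ?h)"
    unfolding test[OF A] test[OF a(1)] test[OF a(2)]
    using opconvexD[OF op a(1,2) pos_semidef_congruence[OF H W] a(3,4)] unfolding A_def[symmetric]
    by (simp add: algebra_simps)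
  also have "t * rtr (?X A1 * ?h) + (1 - t) * rtr (?X A2 * ?h) + ?k
      = t * (rtr (?X A1 * ?h) + ?k) + (1 - t) * (rtr (?X A2 * ?h) + ?k)" by (simp add: algebra_simps)
  also have "\<dots> \<le> t * rtr (mat_fun F (?X A1)) + (1 - t) * rtr (mat_fun F (?X A2))"
    using low[OF a(1)] low[OF a(2)] a by (intro add_mono mult_left_mono) auto
  finally show "rtr (mat_fun F (?X (mix t A1 A2))) \<le> t * rtr (mat_fun F (?X A1)) + (1 - t) * rtr (mat_fun F (?X A2))"
    unfolding A_def by simp
qed

text \<open>If \<open>F\<close> is a lower envelope instead, the optimal auxiliary variable \<open>\<beta>(X A)\<close> has to vary with
  \<open>A\<close>, so the test functional must be jointly convex.\<close>

theorem trace_sandwich_convex_lower: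
  assumes C: "hermitian_mat n C" and H: "H \<in> carrier_mat n n"
    and I: "\<And>A i. pos_def_mat n A \<Longrightarrow> i < n \<Longrightarrow> eig_vals (sandwich C H f A) i \<in> I"
    and \<beta>: "\<And>x. x \<in> I \<Longrightarrow> \<beta> x > 0"
    and le: "\<And>x b. x \<in> I \<Longrightarrow> b > 0 \<Longrightarrow> F x \<le> x * h b + k b"
    and eq: "\<And>x. x \<in> I \<Longrightarrow> F x = x * h (\<beta> x) + k (\<beta> x)"
    and joint: "\<And>A1 A2 B1 B2 t. \<lbrakk>pos_def_mat n A1; pos_def_mat n A2; pos_def_mat n B1; pos_def_mat n B2; 0 \<le> t; t \<le> 1\<rbrakk>
      \<Longrightarrow> rtr (sandwich C H f (mix t A1 A2) * mat_fun h (mix t B1 B2)) + rtr (mat_fun k (mix t B1 B2))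
        \<le> t * (rtr (sandwich C H f A1 * mat_fun h B1) + rtr (mat_fun k B1))
          + (1 - t) * (rtr (sandwich C H f A2 * mat_fun h B2) + rtr (mat_fun k B2))"
  shows "convex_on_pd n (\<lambda>A. rtr (mat_fun F (sandwich C H f A)))"
  unfolding convex_on_pd_def
proof (intro allI impI)
  fix A1 A2 :: "complex mat" and t :: real
  assume a: "pos_def_mat n A1" "pos_def_mat n A2" "0 \<le> t" "t \<le> 1"
  let ?X = "sandwich C H f"
  let ?B = "\<lambda>A. mat_fun \<beta> (?X A)"
  have hX: "hermitian_mat n (?X A)" if "pos_def_mat n A" for A
    using hermitian_sandwich[OF C H pos_defD(1)[OF that]] .
  have B: "pos_def_mat n (?B A)" if "pos_def_mat n A" for A
    using I[OF that] \<beta> by (intro pos_def_mat_fun[OF hX[OF that]]) auto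
  have tight: "rtr (mat_fun F (?X A)) = rtr (?X A * mat_fun h (?B A)) + rtr (mat_fun k (?B A))"
    if "pos_def_mat n A" for A
    using I[OF that] eq by (intro klein_tight[OF hX[OF that]]) auto
  note A = pos_def_comb[OF a] and Bm = pos_def_comb[OF B[OF a(1)] B[OF a(2)] a(3,4)]
  \<comment> \<open>The mixture of the two optimal auxiliary matrices need not be optimal for the
    mixture of A1 and A2, but any admissible one bounds a lower envelope from above.\<close>
  have "rtr (mat_fun F (?X (mix t A1 A2)))
      \<le> rtr (?X (mix t A1 A2) * mat_fun h (mix t (?B A1) (?B A2))) + rtr (mat_fun k (mix t (?B A1) (?B A2)))"
    using I[OF A] pos_defD(2)[OF Bm] le by (intro klein_upper[OF hX[OF A] pos_defD(1)[OF Bm]]) auto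
  also have "\<dots> \<le> t * rtr (mat_fun F (?X A1)) + (1 - t) * rtr (mat_fun F (?X A2))"
    unfolding tight[OF a(1)] tight[OF a(2)] by (rule joint[OF a(1,2) B[OF a(1)] B[OF a(2)] a(3,4)])
  finally show "rtr (mat_fun F (?X (mix t A1 A2))) \<le> t * rtr (mat_fun F (?X A1)) + (1 - t) * rtr (mat_fun F (?X A2))" .
qed

text \<open>The hypotheses present F as the supremum of its supporting lines. Klein's inequality
  with the mixture as auxiliary matrix leaves a functional linear in the matrix, so scalar convexity
  of F suffices in place of operator convexity.\<close>

lemma trace_fun_convex:
  assumes le: "\<And>x z. x > 0 \<Longrightarrow> z > 0 \<Longrightarrow> x * h z + k z \<le> F x"
    and eq: "\<And>x. x > 0 \<Longrightarrow> F x = x * h x + k x"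
    and a: "pos_def_mat n A1" "pos_def_mat n A2" "0 \<le> t" "t \<le> 1"
  shows "rtr (mat_fun F (mix t A1 A2)) \<le> t * rtr (mat_fun F A1) + (1 - t) * rtr (mat_fun F A2)"
proof -
  define A where "A = mix t A1 A2"
  have A: "pos_def_mat n A" unfolding A_def by (rule pos_def_comb[OF a])
  let ?h = "mat_fun h A" and ?k = "rtr (mat_fun k A)"
  have low: "rtr (A' * ?h) + ?k \<le> rtr (mat_fun F A')" if "pos_def_mat n A'" for A'
    using pos_defD(2)[OF that] pos_defD(2)[OF A] le
    by (intro klein_lower[OF pos_defD(1)[OF that] pos_defD(1)[OF A]]) auto
  have "rtr (mat_fun F A) = rtr (A * ?h) + ?k"
    using pos_defD(2)[OF A] eq by (intro klein_equality[OF pos_defD(1)[OF A]]) auto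
  also have "rtr (A * ?h) = t * rtr (A1 * ?h) + (1 - t) * rtr (A2 * ?h)"
    unfolding A_def
    by (rule rtr_mix[OF pos_defD(4)[OF a(1)] pos_defD(4)[OF a(2)] mat_fun_carrier[OF pos_defD(1)[OF A[unfolded A_def]]]])
  also have "\<dots> + ?k = t * (rtr (A1 * ?h) + ?k) + (1 - t) * (rtr (A2 * ?h) + ?k)" by (simp add: algebra_simps)
  also have "\<dots> \<le> t * rtr (mat_fun F A1) + (1 - t) * rtr (mat_fun F A2)"
    using low[OF a(1)] low[OF a(2)] a by (intro add_mono mult_left_mono) auto
  finally show ?thesis unfolding A_def .
qed

section \<open>Powers\<close>

text \<open>Weighted arithmetic-geometric mean inequality for u and 1. With m the weighted
  arithmetic mean, applying ln y <= y - 1 to u/m and 1/m makes the right-hand sides cancel.\<close>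

lemma powr_le_affine:
  assumes "u > 0" "0 \<le> r" "r \<le> 1"
  shows "u powr r \<le> r * u + (1 - r :: real)"
proof -
  define m where "m = r * u + (1 - r)"
  have m: "m > 0" unfolding m_def using assms
    by (cases "r = 1") (auto intro: add_nonneg_pos)
  have "r * ln (u / m) + (1 - r) * ln (1 / m) \<le> r * (u / m - 1) + (1 - r) * (1 / m - 1)"
    using assms m by (intro add_mono mult_left_mono ln_le_minus_one) auto
  also have "\<dots> = (r * u + (1 - r)) / m - 1"
    by (simp add: add_divide_distrib diff_divide_distrib algebra_simps)
  also have "\<dots> = 0" using m by (simp add: m_def)
  finally have "r * ln u \<le> ln m" using assms m by (simp add: ln_div algebra_simps)
  then have "exp (r * ln u) \<le> m" using m by (metis exp_le_cancel_iff exp_ln)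
  then show ?thesis using assms by (simp add: powr_def m_def)
qed

text \<open>Both ranges reduce to \<open>powr_le_affine\<close>: for r >= 1 with exponent 1/r at
  u^r, for r <= 0 with an exponent in [0, 1] at u^(1-r).\<close>

lemma powr_ge_affine:
  assumes "u > 0" "1 \<le> r \<or> r \<le> 0"
  shows "r * u + (1 - r :: real) \<le> u powr r"
  using assms(2)
proof
  assume r: "1 \<le> r"
  have "(u powr r) powr (1 / r) \<le> 1 / r * u powr r + (1 - 1 / r)"
    using r assms by (intro powr_le_affine) auto
  then have "r * u \<le> r * (1 / r * u powr r + (1 - 1 / r))"
    using r assms by (intro mult_left_mono) (auto simp: powr_powr)
  then show ?thesis using r by (simp add: algebra_simps)
next
  assume r: "r \<le> 0"
  \<comment> \<open>Chosen with (1 - r) \<theta> = -r, so that u^(-r) is the \<theta>-th power of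
    u^(1-r); multiplication by (1 - r) u^r then isolates u^r.\<close>
  define \<theta> where "\<theta> = - r / (1 - r)"
  have \<theta>: "0 \<le> \<theta>" "\<theta> \<le> 1" "(1 - r) * \<theta> = - r" "(1 - r) * (1 - \<theta>) = 1"
    using r by (auto simp: \<theta>_def field_simps)
  have "u powr (- r) = (u powr (1 - r)) powr \<theta>" by (simp add: powr_powr \<theta>(3))
  also have "\<dots> \<le> \<theta> * u powr (1 - r) + (1 - \<theta>)" using \<theta> assms by (intro powr_le_affine) auto
  finally have "(1 - r) * u powr r * u powr (- r) \<le> (1 - r) * u powr r * (\<theta> * u powr (1 - r) + (1 - \<theta>))"
    using r by (intro mult_left_mono) auto
  also have "\<dots> = ((1 - r) * \<theta>) * (u powr r * u powr (1 - r)) + ((1 - r) * (1 - \<theta>)) * u powr r"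
    by (simp add: algebra_simps)
  also have "\<dots> = - r * u + u powr r"
    unfolding \<theta> using assms by (simp flip: powr_add)
  also have "(1 - r) * u powr r * u powr (- r) = 1 - r"
    using assms by (simp add: powr_minus)
  finally show ?thesis by simp
qed

text \<open>The value at x of the tangent line to t^r at t = z, grouped as coefficient of x plus
  constant term, the shape that the envelope arguments require.\<close>

definition powr_tangent :: "real \<Rightarrow> real \<Rightarrow> real \<Rightarrow> real" where
  "powr_tangent r x z = r * x * z powr (r - 1) + (1 - r) * z powr r"

lemma powr_tangent_scaled:
  assumes "x > 0" "z > 0"
  shows "powr_tangent r x z = z powr r * (r * (x / z) + (1 - r))" "x powr r = z powr r * (x / z) powr r"
  using assms by (simp_all add: powr_tangent_def powr_diff powr_divide field_simps)

lemma powr_tangent_le: "x > 0 \<Longrightarrow> z > 0 \<Longrightarrow> 1 \<le> r \<or> r \<le> 0 \<Longrightarrow> powr_tangent r x z \<le> x powr r"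
  unfolding powr_tangent_scaled(1) powr_tangent_scaled(2)[of x z]
  by (intro mult_left_mono powr_ge_affine) auto

lemma powr_tangent_ge: "x > 0 \<Longrightarrow> z > 0 \<Longrightarrow> 0 \<le> r \<Longrightarrow> r \<le> 1 \<Longrightarrow> x powr r \<le> powr_tangent r x z"
  unfolding powr_tangent_scaled(1) powr_tangent_scaled(2)[of x z]
  by (intro mult_left_mono powr_le_affine) auto

lemma powr_tangent_same: "x > 0 \<Longrightarrow> powr_tangent r x x = x powr r"
  by (simp add: powr_tangent_scaled(1))

text \<open>The sign \<epsilon>, later 1 or -1, lets one statement serve convexity and concavity.
  The envelope consists of tangent lines, hence the positive weight z^(r-1) with coefficient
  \<epsilon> r.\<close>

theorem power_sandwich_convex_upper:
  assumes op: "opconvex n (\<lambda>x. \<epsilon> * r * x powr s)" and C: "hermitian_mat n C" and H: "H \<in> carrier_mat n n"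
    and pd: "\<And>A. pos_def_mat n A \<Longrightarrow> pos_def_mat n (sandwich C H (\<lambda>x. x powr s) A)"
    and le: "\<And>x z. x > 0 \<Longrightarrow> z > 0 \<Longrightarrow> \<epsilon> * powr_tangent r x z \<le> \<epsilon> * x powr r"
  shows "convex_on_pd n (\<lambda>A. rtr (mat_fun (\<lambda>x. \<epsilon> * x powr r) (sandwich C H (\<lambda>x. x powr s) A)))"
proof (rule trace_sandwich_convex_upper[where I = "{0<..}" and c = "\<epsilon> * r" and w = "\<lambda>z. z powr (r - 1)"
      and k = "\<lambda>z. \<epsilon> * (1 - r) * z powr r"])
  have *: "x * (\<epsilon> * r * z powr (r - 1)) + \<epsilon> * (1 - r) * z powr r = \<epsilon> * powr_tangent r x z" for x z
    by (simp add: powr_tangent_def algebra_simps)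
  show "x * (\<epsilon> * r * z powr (r - 1)) + \<epsilon> * (1 - r) * z powr r \<le> \<epsilon> * x powr r" if "x \<in> {0<..}" "z \<in> {0<..}" for x z
    unfolding * using that le by simp
  show "\<epsilon> * x powr r = x * (\<epsilon> * r * x powr (r - 1)) + \<epsilon> * (1 - r) * x powr r" if "x \<in> {0<..}" for x
    unfolding * using that by (simp add: powr_tangent_same)
qed (use op C H pos_defD(2)[OF pd] in auto)

text \<open>Young's inequality compares \<open>x\<^sup>r\<close> with \<open>r x z\<^bsup>r-1\<^esup> + (1 - r) z\<^sup>r\<close>. The substitution
  \<open>z\<^bsup>r-1\<^esup> = b\<^bsup>1-s\<^esup>\<close> makes the first term jointly convex or concave in \<open>(A, B)\<close>, and turns \<open>z\<^sup>r\<close>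
  into \<open>b\<^sup>e\<close>.\<close>

theorem power_sandwich_convex_lower:
  assumes jc: "jconvex n (\<lambda>x y. \<epsilon> * r * (x powr s * y powr (1 - s)))"
    and C: "pos_semidef_mat n C" and H: "H \<in> carrier_mat n n"
    and pd: "\<And>A. pos_def_mat n A \<Longrightarrow> pos_def_mat n (sandwich C H (\<lambda>x. x powr s) A)"
    and r: "r \<noteq> 1" and s: "s \<noteq> 1" and e: "e = (1 - s) * r / (r - 1)"
    and le: "\<And>x z. x > 0 \<Longrightarrow> z > 0 \<Longrightarrow> \<epsilon> * x powr r \<le> \<epsilon> * powr_tangent r x z"
    and le': "\<And>x z. x > 0 \<Longrightarrow> z > 0 \<Longrightarrow> \<epsilon> * (1 - r) * powr_tangent e x z \<le> \<epsilon> * (1 - r) * x powr e"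
  shows "convex_on_pd n (\<lambda>A. rtr (mat_fun (\<lambda>x. \<epsilon> * x powr r) (sandwich C H (\<lambda>x. x powr s) A)))"
proof -
  let ?f = "\<lambda>x. x powr s" and ?h = "\<lambda>b. \<epsilon> * r * b powr (1 - s)" and ?k = "\<lambda>b. \<epsilon> * (1 - r) * b powr e"
  \<comment> \<open>The tangent is exact at z = x, so the optimal b solves b^(1-s) =
    x^(r-1).\<close>
  let ?\<beta> = "\<lambda>x. x powr ((r - 1) / (1 - s))"
  have \<beta>h: "(?\<beta> x) powr (1 - s) = x powr (r - 1)" for x using s by (simp add: powr_powr)
  have \<beta>k: "(?\<beta> x) powr e = x powr r" for x
  proof -
    have "r - 1 \<noteq> 0" "1 - s \<noteq> 0" using r s by auto
    then have "(r - 1) / (1 - s) * e = r" by (simp add: e)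
    then show ?thesis by (simp add: powr_powr)
  qed
  have tang: "x * (\<epsilon> * r * z powr (r - 1)) + \<epsilon> * (1 - r) * z powr r = \<epsilon> * powr_tangent r x z" for x z
    by (simp add: powr_tangent_def algebra_simps)
  have hC: "hermitian_mat n C" using C by (simp add: pos_semidef_mat_def)
  have op: "opconvex n ?h" by (rule jconvex_imp_opconvex_snd[OF jc]) simp
  show ?thesis
  proof (rule trace_sandwich_convex_lower[where I = "{0<..}" and \<beta> = ?\<beta> and h = ?h and k = ?k, OF hC H])
    show "eig_vals (sandwich C H ?f A) i \<in> {0<..}" if "pos_def_mat n A" "i < n" for A i
      using pos_defD(2)[OF pd[OF that(1)] that(2)] by simp
    show "?\<beta> x > 0" if "x \<in> {0<..}" for x using that by simp
    show "\<epsilon> * x powr r \<le> x * ?h b + ?k b" if "x \<in> {0<..}" "b > 0" for x b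
    proof -
      define z where "z = b powr ((1 - s) / (r - 1))"
      have "z > 0" using that by (simp add: z_def)
      have "z powr (r - 1) = b powr (1 - s)" "z powr r = b powr e"
        using r by (simp_all add: z_def powr_powr e)
      then show ?thesis using le[of x z] that \<open>z > 0\<close> tang[of x z] by simp
    qed
    show "\<epsilon> * x powr r = x * ?h (?\<beta> x) + ?k (?\<beta> x)" if "x \<in> {0<..}" for x
      unfolding \<beta>h \<beta>k tang using that by (simp add: powr_tangent_same)
    fix A1 A2 B1 B2 :: "complex mat" and t :: real
    assume a: "pos_def_mat n A1" "pos_def_mat n A2" "pos_def_mat n B1" "pos_def_mat n B2" "0 \<le> t" "t \<le> 1"
    have split: "rtr (sandwich C H ?f A * mat_fun ?h B)
        = rtr (mat_fun ?h B * C) + bispec (\<lambda>x y. \<epsilon> * r * (x powr s * y powr (1 - s))) A B H"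
      if "pos_def_mat n A" "pos_def_mat n B" for A B
    proof -
      note hA = pos_defD(1)[OF that(1)] and hB = pos_defD(1)[OF that(2)]
      note cB = mat_fun_carrier[OF hB, of ?h] and cA = mat_fun_carrier[OF hA, of ?f]
      have "rtr (mat_fun ?f A * (H * mat_fun ?h B * mat_adjoint H)) = bispec (\<lambda>x y. ?f x * ?h y) A B H"
        unfolding bispec_prod[OF hA hB H] using cA cB H by (simp add: square_mat_simps[of _ n])
      also have "(\<lambda>x y. ?f x * ?h y) = (\<lambda>x y. \<epsilon> * r * (x powr s * y powr (1 - s)))"
        by (simp add: mult_ac)
      finally show ?thesis
        unfolding rtr_sandwich[OF hermitian_carrier[OF hC] H hA cB]
        using rtr_cyclic[OF hermitian_carrier[OF hC] cB] by simp
    qed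
    note mixpd = pos_def_comb[OF a(1,2,5,6)] pos_def_comb[OF a(3,4,5,6)]
    \<comment> \<open>Setting A to the identity in \<open>jc\<close> makes \<open>?h\<close>
      operator convex; as C is positive semidefinite, the constant part of the sandwich contributes
      convexly in B.\<close>
    have 1: "rtr (mat_fun ?h (mix t B1 B2) * C) \<le> t * rtr (mat_fun ?h B1 * C) + (1 - t) * rtr (mat_fun ?h B2 * C)"
      by (rule opconvexD[OF op a(3,4) C a(5,6)])
    have 2: "rtr (mat_fun ?k (mix t B1 B2)) \<le> t * rtr (mat_fun ?k B1) + (1 - t) * rtr (mat_fun ?k B2)"
    proof (rule trace_fun_convex[OF _ _ a(3,4,5,6), where h = "\<lambda>z. \<epsilon> * (1 - r) * (e * z powr (e - 1))"
          and k = "\<lambda>z. \<epsilon> * (1 - r) * ((1 - e) * z powr e)"])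
      have *: "x * (\<epsilon> * (1 - r) * (e * z powr (e - 1))) + \<epsilon> * (1 - r) * ((1 - e) * z powr e)
          = \<epsilon> * (1 - r) * powr_tangent e x z" for x z
        by (simp add: powr_tangent_def algebra_simps)
      show "x * (\<epsilon> * (1 - r) * (e * z powr (e - 1))) + \<epsilon> * (1 - r) * ((1 - e) * z powr e) \<le> ?k x"
        if "x > 0" "z > 0" for x z
        unfolding * by (rule le'[OF that])
      show "?k x = x * (\<epsilon> * (1 - r) * (e * x powr (e - 1))) + \<epsilon> * (1 - r) * ((1 - e) * x powr e)"
        if "x > 0" for x
        unfolding * using that by (simp add: powr_tangent_same)
    qed
    show "rtr (sandwich C H ?f (mix t A1 A2) * mat_fun ?h (mix t B1 B2)) + rtr (mat_fun ?k (mix t B1 B2))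
        \<le> t * (rtr (sandwich C H ?f A1 * mat_fun ?h B1) + rtr (mat_fun ?k B1))
          + (1 - t) * (rtr (sandwich C H ?f A2 * mat_fun ?h B2) + rtr (mat_fun ?k B2))"
      unfolding split[OF a(1,3)] split[OF a(2,4)] split[OF mixpd]
      using 1 2 jconvexD[OF jc a(1-4) H a(5,6)] by (simp add: algebra_simps)
  qed
qed

section \<open>Exponentials\<close>

text \<open>The tangent lines of exp(q x) have slope q exp(q z), so the task reduces to operator
  convexity of q ln x, which is the relative entropy with B the identity, scaled by -q >= 0.\<close>

lemma exp_sandwich_convex:
  assumes C: "hermitian_mat n C" and H: "H \<in> carrier_mat n n" and q: "q \<le> 0"
  shows "convex_on_pd n (\<lambda>A. rtr (mat_fun (\<lambda>x. exp (q * x)) (sandwich C H ln A)))"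
proof (rule trace_sandwich_convex_upper[where I = UNIV and c = q and w = "\<lambda>z. exp (q * z)"
      and k = "\<lambda>z. (1 - q * z) * exp (q * z)", OF _ C H])
  have "jconvex n (\<lambda>x y. - q * (y * ln y - y * ln x))"
    using q by (intro jconvex_cmult relative_entropy_convexity) auto
  then show "opconvex n (\<lambda>x. q * ln x)" by (rule jconvex_imp_opconvex_fst) simp
  show "x * (q * exp (q * z)) + (1 - q * z) * exp (q * z) \<le> exp (q * x)" for x z
  proof -
    have "exp (q * z) * (1 + (q * x - q * z)) \<le> exp (q * z) * exp (q * x - q * z)"
      by (intro mult_left_mono exp_ge_add_one_self) auto
    then show ?thesis by (simp add: algebra_simps flip: exp_add)
  qed
qed (auto simp: algebra_simps)

text \<open>The form at v is |v|^2 - q |H v|^2. The value q = 1 serves the shift matrix for p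
  different from 1, general q the exponential case.\<close>

lemma pos_semidef_id_minus:
  assumes H: "contraction_mat n H" and q: "0 \<le> q" "q \<le> 1"
  shows "pos_semidef_mat n (1\<^sub>m n + complex_of_real (- q) \<cdot>\<^sub>m (mat_adjoint H * H))"
  unfolding pos_semidef_mat_def
proof
  have Hc: "H \<in> carrier_mat n n" using H by (simp add: contraction_mat_def)
  let ?Q = "mat_adjoint H * H"
  have Q: "?Q \<in> carrier_mat n n" using Hc by (simp add: square_mat_simps[of _ n])
  show "hermitian_mat n (1\<^sub>m n + complex_of_real (- q) \<cdot>\<^sub>m ?Q)"
    using Hc by (simp add: hermitian_mat_def adjoint_add[of _ n n] adjoint_smult square_mat_simps[of _ n])
  show "\<forall>v\<in>carrier_vec n. Re (qform (1\<^sub>m n + complex_of_real (- q) \<cdot>\<^sub>m ?Q) v) \<ge> 0"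
  proof
    fix v :: "complex Matrix.vec" assume v: "v \<in> carrier_vec n"
    have Hv: "H *\<^sub>v v \<in> carrier_vec n" by (rule mult_mat_vec_carrier[OF Hc v])
    have "qform ?Q v = (H *\<^sub>v v) \<bullet>c (H *\<^sub>v v)"
      using qform_congruence[OF Hc one_carrier_mat v] qform_one[OF Hv] Hc
      by (simp add: square_mat_simps[of _ n])
    then have "Re (qform (1\<^sub>m n + complex_of_real (- q) \<cdot>\<^sub>m ?Q) v)
        = Re (v \<bullet>c v) - q * Re ((H *\<^sub>v v) \<bullet>c (H *\<^sub>v v))"
      using Q v by (simp add: qform_add[of _ n] qform_smult[of _ n] qform_one)
    moreover have "q * Re ((H *\<^sub>v v) \<bullet>c (H *\<^sub>v v)) \<le> 1 * Re (v \<bullet>c v)"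
    proof (rule mult_mono)
      show "Re ((H *\<^sub>v v) \<bullet>c (H *\<^sub>v v)) \<le> Re (v \<bullet>c v)"
        using H v by (simp add: contraction_mat_def)
      show "Re ((H *\<^sub>v v) \<bullet>c (H *\<^sub>v v)) \<ge> 0"
        using Hv by (simp add: cscalar_sum[of _ n] sum_nonneg)
    qed (use q in auto)
    ultimately show "Re (qform (1\<^sub>m n + complex_of_real (- q) \<cdot>\<^sub>m ?Q) v) \<ge> 0" by simp
  qed
qed

text \<open>Gibbs variational principle: -exp(q x) is the minimum over b > 0 of -q x b + b ln b - b,
  attained at b = exp(q x). The mixed kernel -q y ln x equals q (y ln y - y ln x) - q y ln y. The
  last, concave term is charged to Tr B ln B, which leaves B ln B with the positive semidefinite
  weight 1 - q H^* H.\<close>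

lemma exp_sandwich_concave:
  assumes C: "hermitian_mat n C" and H: "contraction_mat n H" and q: "0 \<le> q" "q \<le> 1"
  shows "concave_on_pd n (\<lambda>A. rtr (mat_fun (\<lambda>x. exp (q * x)) (sandwich C H ln A)))"
proof (rule concave_on_pd_uminus)
  have Hc: "H \<in> carrier_mat n n" using H by (simp add: contraction_mat_def)
  let ?h = "\<lambda>b. - q * b" and ?k = "\<lambda>b. 1 * (b * ln b) + (-1) * b" and ?rel = "\<lambda>x y. y * ln y - y * ln x"
  let ?R = "1\<^sub>m n + complex_of_real (- q) \<cdot>\<^sub>m (mat_adjoint H * H)"
  have R: "pos_semidef_mat n ?R" by (rule pos_semidef_id_minus[OF H q])
  have op: "opconvex n (\<lambda>b. b * ln b)"
    by (rule jconvex_imp_opconvex_snd[OF relative_entropy_convexity]) simp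
  show "convex_on_pd n (\<lambda>A. rtr (mat_fun (\<lambda>x. - exp (q * x)) (sandwich C H ln A)))"
  proof (rule trace_sandwich_convex_lower[where I = UNIV and \<beta> = "\<lambda>x. exp (q * x)" and h = ?h and k = ?k, OF C Hc])
    show "- exp (q * x) \<le> x * ?h b + ?k b" if "b > 0" for x b :: real
    proof -
      have "b * (1 + (q * x - ln b)) \<le> b * exp (q * x - ln b)"
        using that by (intro mult_left_mono exp_ge_add_one_self) auto
      also have "\<dots> = exp (q * x)" using that by (simp add: exp_diff)
      finally show ?thesis by (simp add: algebra_simps)
    qed
    show "- exp (q * x) = x * ?h (exp (q * x)) + ?k (exp (q * x))" for x
      by (simp add: algebra_simps)
    fix A1 A2 B1 B2 :: "complex mat" and t :: real
    assume a: "pos_def_mat n A1" "pos_def_mat n A2" "pos_def_mat n B1" "pos_def_mat n B2" "0 \<le> t" "t \<le> 1"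
    have split: "rtr (sandwich C H ln A * mat_fun ?h B) + rtr (mat_fun ?k B)
        = - q * rtr (B * C) - rtr (B * 1\<^sub>m n) + rtr (mat_fun (\<lambda>b. b * ln b) B * ?R) + q * bispec ?rel A B H"
      if "pos_def_mat n A" "pos_def_mat n B" for A B
    proof -
      note hA = pos_defD(1)[OF that(1)] and hB = pos_defD(1)[OF that(2)]
      note cB = mat_fun_carrier[OF hB, of ?h] and cA = mat_fun_carrier[OF hA, of ln]
        and cE = mat_fun_carrier[OF hB, of "\<lambda>b. b * ln b"] and B = hermitian_carrier[OF hB]
      have hB': "mat_fun ?h B = complex_of_real (- q) \<cdot>\<^sub>m B"
        unfolding mat_fun_cmult[OF hB, of "- q" "\<lambda>x. x"] mat_fun_ident[OF hB] ..
      have "rtr (C * mat_fun ?h B) = rtr (mat_fun ?h B * C)"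
        by (rule rtr_cyclic[OF hermitian_carrier[OF C] cB])
      also have "\<dots> = - q * rtr (B * C)"
        unfolding hB' using B hermitian_carrier[OF C]
        by (simp add: mult_smult_assoc_mat[of _ n n _ n] rtr_smult[of _ n] mult_carrier_mat[of _ n n _ n] del: of_real_minus)
      finally have 1: "rtr (C * mat_fun ?h B) = - q * rtr (B * C)" .
      have "rtr (mat_fun ln A * (H * mat_fun ?h B * mat_adjoint H)) = bispec (\<lambda>x y. ln x * ?h y) A B H"
        unfolding bispec_prod[OF hA hB Hc] using cA cB Hc by (simp add: square_mat_simps[of _ n])
      also have "\<dots> = bispec (\<lambda>x y. q * ?rel x y + (- q) * (y * ln y)) A B H"
        by (simp add: algebra_simps)
      also have "\<dots> = q * bispec ?rel A B H - q * rtr (mat_fun (\<lambda>b. b * ln b) B * (mat_adjoint H * H))"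
        unfolding bispec_add bispec_cmult bispec_right[OF hA hB Hc] by simp
      finally have 2: "rtr (mat_fun ln A * (H * mat_fun ?h B * mat_adjoint H)) = \<dots>" .
      have "mat_fun (\<lambda>b. b * ln b) B * ?R = mat_fun (\<lambda>b. b * ln b) B
          + complex_of_real (- q) \<cdot>\<^sub>m (mat_fun (\<lambda>b. b * ln b) B * (mat_adjoint H * H))"
        using cE Hc
        by (simp add: mult_add_distrib_mat[of _ n n _ n] mult_smult_distrib[of _ n n _ n]
            mult_carrier_mat[of _ n n _ n] right_mult_one_mat[of _ n n] del: of_real_minus)
      then have 3: "rtr (mat_fun (\<lambda>b. b * ln b) B * ?R) = rtr (mat_fun (\<lambda>b. b * ln b) B)
          - q * rtr (mat_fun (\<lambda>b. b * ln b) B * (mat_adjoint H * H))"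
        using cE Hc by (simp add: rtr_add[of _ n] rtr_smult[of _ n] mult_carrier_mat[of _ n n _ n] del: of_real_minus)
      have "rtr (mat_fun ?k B) = rtr (mat_fun (\<lambda>b. b * ln b) B) - rtr B"
        using rtr_mat_fun[OF hB, of ?k] rtr_mat_fun[OF hB, of "\<lambda>b. b * ln b"] rtr_mat_fun[OF hB, of "\<lambda>x. x"]
        unfolding mat_fun_ident[OF hB] by (simp add: sum_subtractf)
      then show ?thesis
        unfolding rtr_sandwich[OF hermitian_carrier[OF C] Hc hA cB] 1 2 3
        using B by (simp add: right_mult_one_mat[of _ n n])
    qed
    note mixpd = pos_def_comb[OF a(1,2,5,6)] pos_def_comb[OF a(3,4,5,6)]
    have 1: "rtr (mat_fun (\<lambda>b. b * ln b) (mix t B1 B2) * ?R)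
        \<le> t * rtr (mat_fun (\<lambda>b. b * ln b) B1 * ?R) + (1 - t) * rtr (mat_fun (\<lambda>b. b * ln b) B2 * ?R)"
      by (rule opconvexD[OF op a(3,4) R a(5,6)])
    have 2: "q * bispec ?rel (mix t A1 A2) (mix t B1 B2) H \<le> q * (t * bispec ?rel A1 B1 H + (1 - t) * bispec ?rel A2 B2 H)"
      using q by (intro mult_left_mono jconvexD[OF relative_entropy_convexity a(1-4) Hc a(5,6)])
    note lin = rtr_mix[OF pos_defD(4)[OF a(3)] pos_defD(4)[OF a(4)], of _ t]
    show "rtr (sandwich C H ln (mix t A1 A2) * mat_fun ?h (mix t B1 B2)) + rtr (mat_fun ?k (mix t B1 B2))
        \<le> t * (rtr (sandwich C H ln A1 * mat_fun ?h B1) + rtr (mat_fun ?k B1))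
          + (1 - t) * (rtr (sandwich C H ln A2 * mat_fun ?h B2) + rtr (mat_fun ?k B2))"
      unfolding split[OF a(1,3)] split[OF a(2,4)] split[OF mixpd] lin[OF hermitian_carrier[OF C]] lin[OF one_carrier_mat]
      using 1 2 by (simp add: algebra_simps)
  qed auto
  show "rtr (mat_fun (\<lambda>x. - exp (q * x)) (sandwich C H ln A)) = - rtr (mat_fun (\<lambda>x. exp (q * x)) (sandwich C H ln A))"
    if "pos_def_mat n A" for A
    unfolding rtr_mat_fun[OF hermitian_sandwich[OF C Hc pos_defD(1)[OF that]]] by (simp add: sum_negf)
qed

section \<open>Deformed exponentials\<close>

text \<open>The matrix \<open>M\<close> for which \<open>exp\<^sub>p (L + H\<^sup>* log\<^sub>p(A) H) = (M + H\<^sup>* A\<^sup>s H)\<^bsup>1/s\<^esup>\<close> with \<open>s = p - 1\<close>.\<close>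

definition shift_mat :: "nat \<Rightarrow> complex mat \<Rightarrow> complex mat \<Rightarrow> real \<Rightarrow> complex mat" where
  "shift_mat n H L s = complex_of_real s \<cdot>\<^sub>m L + (1\<^sub>m n + complex_of_real (- 1) \<cdot>\<^sub>m (mat_adjoint H * H))"

lemma phi_sandwich_exp:
  assumes "H \<in> carrier_mat n n" "hermitian_mat n L" "pos_def_mat n A"
  shows "phi H L 1 q A = rtr (mat_fun (\<lambda>x. exp (q * x)) (sandwich L H ln A))"
proof -
  have "log_p 1 = ln" "exp_p 1 = exp" by (simp_all add: fun_eq_iff log_p_def exp_p_def)
  then have "phi H L 1 q A = rtr (mat_fun (\<lambda>x. x powr q) (mat_fun exp (sandwich L H ln A)))"
    by (simp add: phi_def rtr_def sandwich_def)
  also have "\<dots> = rtr (mat_fun (\<lambda>x. exp x powr q) (sandwich L H ln A))"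
    by (subst mat_fun_comp[OF hermitian_sandwich[OF assms(2,1) pos_defD(1)[OF assms(3)]]]) simp
  finally show ?thesis by (simp add: powr_def)
qed

lemma phi_sandwich_power:
  assumes H: "H \<in> carrier_mat n n" and L: "hermitian_mat n L" and A: "pos_def_mat n A" and p: "p \<noteq> 1"
  shows "phi H L p q A = rtr (mat_fun (\<lambda>x. x powr (q / (p - 1)))
    (sandwich (shift_mat n H L (p - 1)) H (\<lambda>x. x powr (p - 1)) A))"
proof -
  define s where "s = p - 1"
  have s: "s \<noteq> 0" using p by (simp add: s_def)
  note hA = pos_defD(1)[OF A] and Lc = hermitian_carrier[OF L]
  define X where "X = sandwich L H (log_p p) A"
  have hX: "hermitian_mat n X" unfolding X_def by (rule hermitian_sandwich[OF L H hA])
  define P where "P = mat_adjoint H * mat_fun (\<lambda>x. x powr s) A * H"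
  define Q where "Q = mat_adjoint H * H"
  have P: "P \<in> carrier_mat n n" and Q: "Q \<in> carrier_mat n n"
    using H mat_fun_carrier[OF hA] by (simp_all add: P_def Q_def square_mat_simps[of _ n])
  \<comment> \<open>The additive constant -1/s of the deformed logarithm becomes -H^* H after
    compression and scaling by s; together with the 1 inside the deformed exponential it gives 1 -
    H^* H.\<close>
  have "log_p p = (\<lambda>x. 1 / s * x powr s + (- 1 / s) * 1)"
    using p s by (simp add: fun_eq_iff log_p_def s_def[symmetric] diff_divide_distrib)
  then have "mat_fun (log_p p) A = complex_of_real (1 / s) \<cdot>\<^sub>m mat_fun (\<lambda>x. x powr s) A
      + complex_of_real (- 1 / s) \<cdot>\<^sub>m 1\<^sub>m n"
    using mat_fun_linear[OF hA, of "1 / s" "\<lambda>x. x powr s" "- 1 / s" "\<lambda>x. 1"]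
    unfolding mat_fun_one[OF hA] by simp
  then have "X = L + mat_adjoint H * (complex_of_real (1 / s) \<cdot>\<^sub>m mat_fun (\<lambda>x. x powr s) A
      + complex_of_real (- 1 / s) \<cdot>\<^sub>m 1\<^sub>m n) * H"
    by (simp add: X_def sandwich_def)
  also have "\<dots> = L + (complex_of_real (1 / s) \<cdot>\<^sub>m P + complex_of_real (- 1 / s) \<cdot>\<^sub>m Q)"
    using H mat_fun_carrier[OF hA, of "\<lambda>x. x powr s"] unfolding P_def Q_def
    by (simp add: mult_add_distrib_mat[of _ n n _ n] add_mult_distrib_mat[of _ n n _ _ n]
        mult_smult_distrib[of _ n n _ n] mult_smult_assoc_mat[of _ n n _ n]
        mult_carrier_mat[of _ n n _ n] right_mult_one_mat[of _ n n]
        del: of_real_divide of_real_minus)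
  finally have X: "X = \<dots>" .
  have "complex_of_real s \<cdot>\<^sub>m X + complex_of_real 1 \<cdot>\<^sub>m 1\<^sub>m n = sandwich (shift_mat n H L s) H (\<lambda>x. x powr s) A"
    unfolding X sandwich_def shift_mat_def P_def[symmetric] Q_def[symmetric]
    using Lc P Q s by (intro eq_matI) (auto simp: field_simps)
  then have Y: "mat_fun (\<lambda>x. s * x + 1 * 1) X = sandwich (shift_mat n H L s) H (\<lambda>x. x powr s) A"
    unfolding mat_fun_linear[OF hX, of s "\<lambda>x. x" 1 "\<lambda>x. 1"] mat_fun_ident[OF hX] mat_fun_one[OF hX] .
  have "phi H L p q A = rtr (mat_fun (\<lambda>x. x powr q) (mat_fun (exp_p p) X))"
    by (simp add: phi_def rtr_def X_def sandwich_def)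
  also have "\<dots> = rtr (mat_fun (\<lambda>x. (s * x + 1 * 1) powr (q / s)) X)"
    unfolding mat_fun_comp[OF hX] using p by (simp add: exp_p_def powr_powr mult.commute s_def)
  also have "\<dots> = rtr (mat_fun (\<lambda>x. x powr (q / s)) (sandwich (shift_mat n H L s) H (\<lambda>x. x powr s) A))"
    unfolding Y[symmetric] mat_fun_comp[OF hX] ..
  finally show ?thesis by (simp add: s_def)
qed

text \<open>Strict positivity has two sources: if H v is nonzero, the positive definite A^s
  contributes; if H v = 0, the term 1 - H^* H contributes |v|^2.\<close>

lemma
  assumes H: "contraction_mat n H" and L: "hermitian_mat n L"
    and sL: "\<And>v. v \<in> carrier_vec n \<Longrightarrow> s * Re (qform L v) \<ge> 0"
  shows pos_semidef_shift_mat: "pos_semidef_mat n (shift_mat n H L s)"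
    and pos_def_sandwich_shift_mat: "pos_def_mat n A \<Longrightarrow> pos_def_mat n (sandwich (shift_mat n H L s) H (\<lambda>x. x powr s) A)"
proof -
  have Hc: "H \<in> carrier_mat n n" using H by (simp add: contraction_mat_def)
  let ?R = "1\<^sub>m n + complex_of_real (- 1) \<cdot>\<^sub>m (mat_adjoint H * H)"
  have R: "pos_semidef_mat n ?R" by (rule pos_semidef_id_minus[OF H]) auto
  then have hR: "hermitian_mat n ?R" by (simp add: pos_semidef_mat_def)
  note Lc = hermitian_carrier[OF L] and Rc = hermitian_carrier[OF hR]
  have hM: "hermitian_mat n (shift_mat n H L s)"
    unfolding shift_mat_def
    by (rule hermitian_add[OF _ hR]) (use L in \<open>simp add: hermitian_mat_def adjoint_smult\<close>)
  have qf: "Re (qform (shift_mat n H L s) v) = s * Re (qform L v) + Re (qform ?R v)" if "v \<in> carrier_vec n" for v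
    using Lc Rc that by (simp add: shift_mat_def qform_add[of _ n] qform_smult[of _ n] del: of_real_minus)
  have nonneg: "Re (qform (shift_mat n H L s) v) \<ge> 0" if "v \<in> carrier_vec n" for v
    unfolding qf[OF that] using sL[OF that] R that unfolding pos_semidef_mat_def by (intro add_nonneg_nonneg) blast+
  then show M: "pos_semidef_mat n (shift_mat n H L s)" using hM by (simp add: pos_semidef_mat_def)
  assume A: "pos_def_mat n A"
  let ?F = "mat_fun (\<lambda>x. x powr s) A"
  have F: "pos_def_mat n ?F" using pos_defD(2)[OF A] by (intro pos_def_mat_fun[OF pos_defD(1)[OF A]]) force
  have Fc: "?F \<in> carrier_mat n n" by (rule pos_defD(4)[OF F])
  show "pos_def_mat n (sandwich (shift_mat n H L s) H (\<lambda>x. x powr s) A)"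
    unfolding pos_def_mat_def
  proof (intro conjI ballI impI)
    show "hermitian_mat n (sandwich (shift_mat n H L s) H (\<lambda>x. x powr s) A)"
      by (rule hermitian_sandwich[OF hM Hc pos_defD(1)[OF A]])
    fix v :: "complex Matrix.vec" assume v: "v \<in> carrier_vec n" "v \<noteq> 0\<^sub>v n"
    have Hv: "H *\<^sub>v v \<in> carrier_vec n" by (rule mult_mat_vec_carrier[OF Hc v(1)])
    have eq: "Re (qform (sandwich (shift_mat n H L s) H (\<lambda>x. x powr s) A) v)
        = Re (qform (shift_mat n H L s) v) + Re (qform ?F (H *\<^sub>v v))"
      unfolding sandwich_def using qform_congruence[OF Hc Fc v(1)] hermitian_carrier[OF hM] Hc Fc v(1)
      by (simp add: qform_add[of _ n] square_mat_simps[of _ n])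
    show "Re (qform (sandwich (shift_mat n H L s) H (\<lambda>x. x powr s) A) v) > 0"
    proof (cases "H *\<^sub>v v = 0\<^sub>v n")
      case False
      then have "Re (qform ?F (H *\<^sub>v v)) > 0" using F Hv by (simp add: pos_def_mat_def)
      then show ?thesis unfolding eq using nonneg[OF v(1)] by simp
    next
      case True
      have Q: "mat_adjoint H * H \<in> carrier_mat n n" using Hc by (simp add: square_mat_simps[of _ n])
      have "qform (mat_adjoint H * H) v = (H *\<^sub>v v) \<bullet>c (H *\<^sub>v v)"
        using qform_congruence[OF Hc one_carrier_mat v(1)] qform_one[OF Hv] Hc
        by (simp add: square_mat_simps[of _ n])
      also have "\<dots> = 0" unfolding True by simp
      finally have "Re (qform ?R v) = Re (v \<bullet>c v)"
        using Q v(1) by (simp add: qform_add[of _ n] qform_smult[of _ n] qform_one)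
      then have "Re (qform (shift_mat n H L s) v) > 0"
        unfolding qf[OF v(1)] using sL[OF v(1)] cscalar_self_pos[OF v] by simp
      moreover have "Re (qform ?F (H *\<^sub>v v)) \<ge> 0"
        using pos_defD(3)[OF F] Hv unfolding pos_semidef_mat_def by blast
      ultimately show ?thesis unfolding eq by simp
    qed
  qed
qed

lemma rtr_mat_fun_cmult:
  "hermitian_mat n A \<Longrightarrow> rtr (mat_fun (\<lambda>x. c * f x) A) = c * rtr (mat_fun f A)"
  by (simp add: rtr_mat_fun sum_distrib_left)

text \<open>Nonnegativity of the form of s L covers L <= 0 for p < 1 and L >= 0 for p > 1 at
  once.\<close>

locale power_case =
  fixes n :: nat and H L :: "complex mat" and p s q r :: real
  assumes H: "contraction_mat n H" and L: "hermitian_mat n L"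
    and sL: "\<And>v. v \<in> carrier_vec n \<Longrightarrow> s * Re (qform L v) \<ge> 0"
    and p: "p \<noteq> 1" and s_def: "s = p - 1" and r_def: "r = q / s"
begin

lemma Hc: "H \<in> carrier_mat n n" using H by (simp add: contraction_mat_def)

lemma s_nonzero: "s \<noteq> 0" using p by (simp add: s_def)

lemma M: "pos_semidef_mat n (shift_mat n H L s)"
  using H L sL by (rule pos_semidef_shift_mat)

lemma Y: "pos_def_mat n A \<Longrightarrow> pos_def_mat n (sandwich (shift_mat n H L s) H (\<lambda>x. x powr s) A)"
  using H L sL by (rule pos_def_sandwich_shift_mat)

lemma phi_eq:
  assumes "pos_def_mat n A"
  shows "rtr (mat_fun (\<lambda>x. \<epsilon> * x powr r) (sandwich (shift_mat n H L s) H (\<lambda>x. x powr s) A)) = \<epsilon> * phi H L p q A"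
  unfolding rtr_mat_fun_cmult[OF pos_defD(1)[OF Y[OF assms]]] phi_sandwich_power[OF Hc L assms p]
  by (simp add: s_def r_def)

lemma convex_upper:
  assumes "opconvex n (\<lambda>x. \<epsilon> * r * x powr s)"
    and "\<And>x z. x > 0 \<Longrightarrow> z > 0 \<Longrightarrow> \<epsilon> * powr_tangent r x z \<le> \<epsilon> * x powr r"
  shows "convex_on_pd n (\<lambda>A. \<epsilon> * phi H L p q A)"
  using M by (intro convex_on_pd_cong[OF power_sandwich_convex_upper[OF assms(1) _ Hc Y assms(2)] phi_eq])
    (auto simp: pos_semidef_mat_def)

lemma convex_lower:
  assumes "jconvex n (\<lambda>x y. \<epsilon> * r * (x powr s * y powr (1 - s)))" "r \<noteq> 1" "s \<noteq> 1"
    and "\<And>x z. x > 0 \<Longrightarrow> z > 0 \<Longrightarrow> \<epsilon> * x powr r \<le> \<epsilon> * powr_tangent r x z"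
    and "\<And>x z e. x > 0 \<Longrightarrow> z > 0 \<Longrightarrow> e = (1 - s) * r / (r - 1) \<Longrightarrow>
       \<epsilon> * (1 - r) * powr_tangent e x z \<le> \<epsilon> * (1 - r) * x powr e"
  shows "convex_on_pd n (\<lambda>A. \<epsilon> * phi H L p q A)"
  using assms(5)
  by (intro convex_on_pd_cong[OF power_sandwich_convex_lower[OF assms(1) M Hc Y assms(2,3) refl assms(4)] phi_eq]) auto

lemma concave_phi: "convex_on_pd n (\<lambda>A. - 1 * phi H L p q A) \<Longrightarrow> concave_on_pd n (phi H L p q)"
  by (erule concave_on_pd_uminus) simp

lemma convex_phi: "convex_on_pd n (\<lambda>A. 1 * phi H L p q A) \<Longrightarrow> convex_on_pd n (phi H L p q)"
  by simp

text \<open>Since r <= 0, -x^r lies below its tangent lines, which calls for the lower envelope,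
  with Ando convexity and the factor -r >= 0. The bound q <= 1 gives e = (1-s) q / (q-s) <= 1, so
  t^e is concave and -(1-r) t^e convex.\<close>

lemma case_a:
  assumes "- 1 \<le> s" "s < 0" "0 \<le> q" "q \<le> 1"
  shows "concave_on_pd n (phi H L p q)"
proof (rule concave_phi, rule convex_lower)
  have r: "r \<le> 0" using assms by (simp add: r_def divide_nonneg_neg)
  show "jconvex n (\<lambda>x y. - 1 * r * (x powr s * y powr (1 - s)))"
    using assms r by (intro jconvex_cmult ando_convexity_neg) auto
  show "r \<noteq> 1" "s \<noteq> 1" using r assms by auto
  show "- 1 * x powr r \<le> - 1 * powr_tangent r x z" if "x > 0" "z > 0" for x z
    using powr_tangent_le[OF that] r by simp
  fix x z e :: real assume xz: "x > 0" "z > 0" and e: "e = (1 - s) * r / (r - 1)"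
  have e_eq: "e = (1 - s) * q / (q - s)"
    using assms s_nonzero by (simp add: e r_def divide_simps)
  have "0 \<le> e" "e \<le> 1"
  proof -
    have "s * q \<ge> s" using mult_left_mono_neg[of q 1 s] assms by simp
    moreover have "s * q \<le> 0" using assms by (intro mult_nonpos_nonneg) auto
    ultimately show "0 \<le> e" "e \<le> 1" unfolding e_eq using assms by (auto simp: field_simps)
  qed
  then have "x powr e \<le> powr_tangent e x z" by (intro powr_tangent_ge xz)
  then show "- 1 * (1 - r) * powr_tangent e x z \<le> - 1 * (1 - r) * x powr e"
    using r by (intro mult_left_mono_neg) auto
qed

text \<open>For r <= 1 the function -x^r is convex, and operator concavity of x^s suffices. For r >
  1 it is concave and joint Lieb concavity takes over; there s < q <= 1 excludes s = 1, and q <= 1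
  gives e >= 1, with -(1-r) positive.\<close>

lemma case_b:
  assumes "0 < s" "s \<le> 1" "0 \<le> q" "q \<le> 1"
  shows "concave_on_pd n (phi H L p q)"
proof (rule concave_phi)
  have r0: "0 \<le> r" using assms by (simp add: r_def)
  have jc: "jconvex n (\<lambda>x y. r * - (x powr s * y powr (1 - s)))"
    using assms r0 by (intro jconvex_cmult lieb_concavity) auto
  show "convex_on_pd n (\<lambda>A. - 1 * phi H L p q A)"
  proof (cases "r \<le> 1")
    case True
    show ?thesis
    proof (rule convex_upper)
      show "opconvex n (\<lambda>x. - 1 * r * x powr s)" by (rule jconvex_imp_opconvex_fst[OF jc]) simp
    qed (use r0 True powr_tangent_ge in auto)
  next
    case False
    then have "s < q" using assms by (simp add: r_def field_simps)
    show ?thesis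
    proof (rule convex_lower)
      show "jconvex n (\<lambda>x y. - 1 * r * (x powr s * y powr (1 - s)))" using jc by simp
      show "r \<noteq> 1" "s \<noteq> 1" using False assms \<open>s < q\<close> by auto
      show "- 1 * x powr r \<le> - 1 * powr_tangent r x z" if "x > 0" "z > 0" for x z
        using powr_tangent_le[OF that] False by simp
      fix x z e :: real assume xz: "x > 0" "z > 0" and e: "e = (1 - s) * r / (r - 1)"
      have e_eq: "e = (1 - s) * q / (q - s)"
        using assms s_nonzero by (simp add: e r_def divide_simps)
      have "s * q \<le> s" using mult_left_mono[of q 1 s] assms by simp
      then have "1 \<le> e" unfolding e_eq using \<open>s < q\<close> by (simp add: field_simps)
      then have "powr_tangent e x z \<le> x powr e" by (intro powr_tangent_le xz) simp
      then show "- 1 * (1 - r) * powr_tangent e x z \<le> - 1 * (1 - r) * x powr e"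
        using False by (intro mult_left_mono) auto
    qed
  qed
qed

text \<open>Here r >= 0. Operator convexity of x^s suffices for r >= 1; for r < 1 the power x^r is
  concave, and Ando convexity is used jointly, with e <= 0 because r - 1 is negative.\<close>

lemma case_c:
  assumes "- 1 \<le> s" "s < 0" "q \<le> 0"
  shows "convex_on_pd n (phi H L p q)"
proof (rule convex_phi)
  have r0: "0 \<le> r" using assms by (simp add: r_def divide_nonpos_neg)
  have jc: "jconvex n (\<lambda>x y. r * (x powr s * y powr (1 - s)))"
    using assms r0 by (intro jconvex_cmult ando_convexity_neg) auto
  show "convex_on_pd n (\<lambda>A. 1 * phi H L p q A)"
  proof (cases "r \<ge> 1")
    case True
    show ?thesis
    proof (rule convex_upper)
      show "opconvex n (\<lambda>x. 1 * r * x powr s)" by (rule jconvex_imp_opconvex_fst[OF jc]) simp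
    qed (use True powr_tangent_le in auto)
  next
    case False
    show ?thesis
    proof (rule convex_lower)
      show "jconvex n (\<lambda>x y. 1 * r * (x powr s * y powr (1 - s)))" using jc by simp
      show "r \<noteq> 1" "s \<noteq> 1" using False assms by auto
      show "1 * x powr r \<le> 1 * powr_tangent r x z" if "x > 0" "z > 0" for x z
        using powr_tangent_ge[OF that] r0 False by simp
      fix x z e :: real assume xz: "x > 0" "z > 0" and e: "e = (1 - s) * r / (r - 1)"
      have "e \<le> 0" unfolding e using r0 False assms by (intro divide_nonneg_neg mult_nonneg_nonneg) auto
      then have "powr_tangent e x z \<le> x powr e" by (intro powr_tangent_le xz) simp
      then show "1 * (1 - r) * powr_tangent e x z \<le> 1 * (1 - r) * x powr e"
        using False by (intro mult_left_mono) auto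
    qed
  qed
qed

text \<open>With r <= 0 the power x^r is convex, and r turns the operator concave x^s into an
  operator convex function, so the upper envelope suffices for every q <= 0.\<close>

lemma case_d:
  assumes "0 < s" "s \<le> 1" "q \<le> 0"
  shows "convex_on_pd n (phi H L p q)"
proof (rule convex_phi, rule convex_upper)
  have r0: "r \<le> 0" using assms by (simp add: r_def divide_nonpos_pos)
  have "jconvex n (\<lambda>x y. - r * - (x powr s * y powr (1 - s)))"
    using assms r0 by (intro jconvex_cmult lieb_concavity) auto
  then show "opconvex n (\<lambda>x. 1 * r * x powr s)" by (rule jconvex_imp_opconvex_fst) simp
  show "1 * powr_tangent r x z \<le> 1 * x powr r" if "x > 0" "z > 0" for x z
    using powr_tangent_le[OF that] r0 by simp
qed

text \<open>The two envelopes meet at q = s. For q < s the power x^r is concave, and e = (s-1) q /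
  (s-q) is at least 1 precisely because q >= 1.\<close>

lemma case_e:
  assumes "1 \<le> s" "s \<le> 2" "1 \<le> q"
  shows "convex_on_pd n (phi H L p q)"
proof (rule convex_phi)
  have r0: "0 < r" using assms by (simp add: r_def)
  have jc: "jconvex n (\<lambda>x y. r * (x powr s * y powr (1 - s)))"
    using assms r0 by (intro jconvex_cmult ando_convexity) auto
  show "convex_on_pd n (\<lambda>A. 1 * phi H L p q A)"
  proof (cases "r \<ge> 1")
    case True
    show ?thesis
    proof (rule convex_upper)
      show "opconvex n (\<lambda>x. 1 * r * x powr s)" by (rule jconvex_imp_opconvex_fst[OF jc]) simp
    qed (use True powr_tangent_le in auto)
  next
    case False
    then have "q < s" using assms by (simp add: r_def field_simps)
    show ?thesis
    proof (rule convex_lower)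
      show "jconvex n (\<lambda>x y. 1 * r * (x powr s * y powr (1 - s)))" using jc by simp
      show "r \<noteq> 1" "s \<noteq> 1" using False assms \<open>q < s\<close> by auto
      show "1 * x powr r \<le> 1 * powr_tangent r x z" if "x > 0" "z > 0" for x z
        using powr_tangent_ge[OF that] r0 False by simp
      fix x z e :: real assume xz: "x > 0" "z > 0" and e: "e = (1 - s) * r / (r - 1)"
      have e_eq: "e = (s - 1) * q / (s - q)"
        using assms \<open>q < s\<close> s_nonzero by (simp add: e r_def divide_simps) (simp add: algebra_simps)
      have "s * q \<ge> s" using mult_left_mono[of 1 q s] assms by simp
      then have "1 \<le> e" unfolding e_eq using \<open>q < s\<close> by (simp add: field_simps)
      then have "powr_tangent e x z \<le> x powr e" by (intro powr_tangent_le xz) simp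
      then show "1 * (1 - r) * powr_tangent e x z \<le> 1 * (1 - r) * x powr e"
        using False by (intro mult_left_mono) auto
    qed
  qed
qed

end

theorem theorem4p1:
  fixes n :: nat and H L :: "complex mat" and p q :: real
  assumes "0 < n"
    and "contraction_mat n H"
    and "hermitian_mat n L"
  shows "(0 \<le> p \<and> p \<le> 1 \<and> pos_semidef_mat n (- L) \<and> 0 \<le> q \<and> q \<le> 1
            \<longrightarrow> concave_on_pd n (phi H L p q))
       \<and> (1 \<le> p \<and> p \<le> 2 \<and> pos_semidef_mat n L \<and> 0 \<le> q \<and> q \<le> 1
            \<longrightarrow> concave_on_pd n (phi H L p q))
       \<and> (0 \<le> p \<and> p \<le> 1 \<and> pos_semidef_mat n (- L) \<and> q \<le> 0
            \<longrightarrow> convex_on_pd n (phi H L p q))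
       \<and> (1 \<le> p \<and> p \<le> 2 \<and> pos_semidef_mat n L \<and> q \<le> 0
            \<longrightarrow> convex_on_pd n (phi H L p q))
       \<and> (2 \<le> p \<and> p \<le> 3 \<and> pos_semidef_mat n L \<and> 1 \<le> q
            \<longrightarrow> convex_on_pd n (phi H L p q))"
proof -
  have Hc: "H \<in> carrier_mat n n" using assms(2) by (simp add: contraction_mat_def)
  \<comment> \<open>The value p = 1 belongs to the ranges of (a) to (d) but not to the locale, which
    divides by p - 1.\<close>
  have concave1: "concave_on_pd n (phi H L 1 q)" if "0 \<le> q" "q \<le> 1"
    by (rule concave_on_pd_cong[OF exp_sandwich_concave[OF assms(3,2) that]])
      (simp add: phi_sandwich_exp[OF Hc assms(3)])
  have convex1: "convex_on_pd n (phi H L 1 q)" if "q \<le> 0"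
    by (rule convex_on_pd_cong[OF exp_sandwich_convex[OF assms(3) Hc that]])
      (simp add: phi_sandwich_exp[OF Hc assms(3)])
  have neg: "power_case n H L p (p - 1) q (q / (p - 1))" if "p < 1" "pos_semidef_mat n (- L)"
  proof (unfold_locales)
    fix v :: "complex Matrix.vec" assume v: "v \<in> carrier_vec n"
    have "- L = complex_of_real (- 1) \<cdot>\<^sub>m L" by (intro eq_matI) auto
    then have "Re (qform (- L) v) = - Re (qform L v)"
      using qform_smult[OF hermitian_carrier[OF assms(3)] v, of "complex_of_real (- 1)"] by simp
    then have "Re (qform L v) \<le> 0" using that(2) v unfolding pos_semidef_mat_def by force
    then show "(p - 1) * Re (qform L v) \<ge> 0" using that(1) by (intro mult_nonpos_nonpos) auto
  qed (use assms that in auto)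
  have pos: "power_case n H L p (p - 1) q (q / (p - 1))" if "1 < p" "pos_semidef_mat n L"
    by unfold_locales (use assms that in \<open>auto simp: pos_semidef_mat_def\<close>)
  show ?thesis
  proof (intro conjI impI; elim conjE)
    assume a: "0 \<le> p" "p \<le> 1" "pos_semidef_mat n (- L)" "0 \<le> q" "q \<le> 1"
    show "concave_on_pd n (phi H L p q)"
      using concave1 power_case.case_a[OF neg] a by (cases "p = 1") auto
  next
    assume a: "1 \<le> p" "p \<le> 2" "pos_semidef_mat n L" "0 \<le> q" "q \<le> 1"
    show "concave_on_pd n (phi H L p q)"
      using concave1 power_case.case_b[OF pos] a by (cases "p = 1") auto
  next
    assume a: "0 \<le> p" "p \<le> 1" "pos_semidef_mat n (- L)" "q \<le> 0"
    show "convex_on_pd n (phi H L p q)"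
      using convex1 power_case.case_c[OF neg] a by (cases "p = 1") auto
  next
    assume a: "1 \<le> p" "p \<le> 2" "pos_semidef_mat n L" "q \<le> 0"
    show "convex_on_pd n (phi H L p q)"
      using convex1 power_case.case_d[OF pos] a by (cases "p = 1") auto
  next
    assume a: "2 \<le> p" "p \<le> 3" "pos_semidef_mat n L" "1 \<le> q"
    show "convex_on_pd n (phi H L p q)"
      using power_case.case_e[OF pos] a by auto
  qed
qed

end
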